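(* In a finite dynamic game as described in the context, let $K=(K^i)_{i\in\mathcal{I}}$ be compressed information generated by fixed update maps. If $K$ is mutually sufficient information, then there exists at least one $K$-based Bayes–Nash equilibrium, i.e. a profile $\rho=(\rho^i)_{i\in\mathcal{I}}$ of $K^i$-based strategies such that for every player $i$ and every (full-history) behavioral strategy $\tilde g^i$ of player $i$, $J^i(\rho)\ge J^i(\tilde g^i,\rho^{-i})$.
   Context: Game model: finite set of players $\mathcal{I}$, times $\mathcal{T}=\{1,\dots,T\}$. At time $t$ each player $i$ takes action $U_t^i\in\mathcal{U}_t^i$, obtains reward $R_t^i\in[-1,1]$ and learns new information $Z_t^i\in\mathcal{Z}_t^i$. There is a state $X_t\in\mathcal{X}_t$ with $(X_{t+1},Z_t,R_t)=f_t(X_t,U_t,W_t)$ for fixed functions $f_t$, where $U_t=(U_t^i)_i$, $Z_t=(Z_t^i)_i$, $R_t=(R_t^i)_i$. The primitive random variables are $(X_1,H_1)$ (with $H_1=(H_1^i)_i$ the initial information, possibly correlated with $X_1$) and $W_1,\dots,W_T$; the vector $(X_1,H_1)$ and $W_1,\dots,W_T$ are mutually independent with commonly known distributions. All sets $\mathcal{X}_t,\mathcal{U}_t,\mathcal{Z}_t,\mathcal{W}_t,\mathcal{H}_1$ are finite. Perfect recall: player $i$'s information at time $t$ is $H_t^i=(H_1^i,Z_{1:t-1}^i)\in\mathcal{H}_t^i$, and $U_t^i$ is a component of $Z_t^i$. A behavioral strategy $g^i=(g_t^i)_t$ has $g_t^i:\mathcal{H}_t^i\to\Delta(\mathcal{U}_t^i)$;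 payoff $J^i(g)=\mathbb{E}^g[\sum_{t=1}^T R_t^i]$. $\Pr^g,\mathbb{E}^g$ denote probability/expectation under profile $g$. A realization is admissible under a partially specified profile (e.g. $g^{-i}$) if it has positive probability under some completion of that profile. Compression: for each $i$, $K_1^i=\iota_1^i(H_1^i)$, $K_t^i=\iota_t^i(K_{t-1}^i,Z_{t-1}^i)$ for fixed maps $\iota_t^i$, with values in finite sets $\mathcal{K}_t^i$; $k_t^i$ denotes the compression of $h_t^i$. A $K^i$-based strategy is $\rho^i=(\rho_t^i)_t$ with $\rho_t^i:\mathcal{K}_t^i\to\Delta(\mathcal{U}_t^i)$; a $K$-based profile has every player using a $K^i$-based strategy. Information state: given $g^{-i}$, $K^i$ is an information state under $g^{-i}$ if there exist functions $P_t^{i,g^{-i}}:\mathcal{K}_t^i\times\mathcal{U}_t^i\to\Delta(\mathcal{K}_{t+1}^i)$ and $r_t^{i,g^{-i}}:\mathcal{K}_t^i\times\mathcal{U}_t^i\to[-1,1]$ (not depending on $g^i$) with $\Pr^{g^i,g^{-i}}(k_{t+1}^i\mid h_t^i,u_t^i)=P_t^{i,g^{-i}}(k_{t+1}^i\mid k_t^i,u_t^i)$ for $t<T$ and $\mathbb{E}^{g^i,g^{-i}}[R_t^i\mid h_t^i,u_t^i]=r_t^{i,g^{-i}}(k_t^i,u_t^i)$ for all $t$, for all $g^i$ and all $(h_t^i,u_t^i)$ admissible under $(g^i,g^{-i})$. Mutually sufficient information (MSI): $K$ is MSI if for every player $i$ and every profile $\rho^{-i}$ of $K^{j}$-based strategies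 of the players $j\ne i$, $K^i$ is an information state under $\rho^{-i}$. *)

theory Defs
  imports "HOL-Probability.Probability"
begin

text \<open>
  Finite dynamic game.  Players: the finite type 'i.  Times 1..T.
  The primitive randomness is (X_1, H_1) with joint law mu0 and W_t with law Wd t,
  mutually independent (built into the construction of the trajectory law below).
  Dynamics: f t x u w = (X_{t+1}, Zo_t, R_t), where the new information of player i
  is Z_t^i = (U_t^i, Zo_t^i), i.e. the own action is a component of Z_t^i.
  Admissible actions of player i at time t: Uset t i.
\<close>

type_synonym ('i,'u,'z) srec = "('i \<Rightarrow> 'u) \<times> ('i \<Rightarrow> 'z) \<times> ('i \<Rightarrow> real)"
type_synonym ('x,'i,'h,'u,'z) traj = "'x \<times> ('i \<Rightarrow> 'h) \<times> ('i,'u,'z) srec list"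
type_synonym ('h,'u,'z) hist = "'h \<times> ('u \<times> 'z) list"
text \<open>behavioral strategy of one player: time, history H_t^i = (H_1^i, Z_{1:t-1}^i) to a distribution\<close>
type_synonym ('h,'u,'z) bstrat = "nat \<Rightarrow> ('h,'u,'z) hist \<Rightarrow> 'u pmf"
type_synonym ('k,'u) kstrat = "nat \<Rightarrow> 'k \<Rightarrow> 'u pmf"

definition hist_of :: "('x,'i,'h,'u,'z) traj \<Rightarrow> 'i \<Rightarrow> ('h,'u,'z) hist" where
  "hist_of s i = (case s of (x, h1, recs) \<Rightarrow> (h1 i, map (\<lambda>(u, zo, r). (u i, zo i)) recs))"

definition step ::
  "(nat \<Rightarrow> 'x \<Rightarrow> ('i \<Rightarrow> 'u) \<Rightarrow> 'w \<Rightarrow> 'x \<times> ('i \<Rightarrow> 'z) \<times> ('i \<Rightarrow> real))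
   \<Rightarrow> (nat \<Rightarrow> 'w pmf) \<Rightarrow> ('i::finite \<Rightarrow> ('h,'u,'z) bstrat) \<Rightarrow> nat
   \<Rightarrow> ('x,'i,'h,'u,'z) traj \<Rightarrow> ('x,'i,'h,'u,'z) traj pmf" where
  "step f Wd g t s =
     bind_pmf (Pi_pmf UNIV undefined (\<lambda>i. g i t (hist_of s i))) (\<lambda>u.
     bind_pmf (Wd t) (\<lambda>w.
     return_pmf (case s of (x, h1, recs) \<Rightarrow>
                 (case f t x u w of (x', zo, r) \<Rightarrow> (x', h1, recs @ [(u, zo, r)])))))"

primrec traj ::
  "(nat \<Rightarrow> 'x \<Rightarrow> ('i \<Rightarrow> 'u) \<Rightarrow> 'w \<Rightarrow> 'x \<times> ('i \<Rightarrow> 'z) \<times> ('i \<Rightarrow> real))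
   \<Rightarrow> ('x \<times> ('i \<Rightarrow> 'h)) pmf \<Rightarrow> (nat \<Rightarrow> 'w pmf) \<Rightarrow> ('i::finite \<Rightarrow> ('h,'u,'z) bstrat)
   \<Rightarrow> nat \<Rightarrow> ('x,'i,'h,'u,'z) traj pmf" where
  "traj f mu0 Wd g 0 = map_pmf (\<lambda>(x, h1). (x, h1, [])) mu0"
| "traj f mu0 Wd g (Suc n) = bind_pmf (traj f mu0 Wd g n) (step f Wd g (Suc n))"

definition Hv :: "'i \<Rightarrow> nat \<Rightarrow> ('x,'i,'h,'u,'z) traj \<Rightarrow> ('h,'u,'z) hist" where
  "Hv i t s = (case s of (x, h1, recs) \<Rightarrow> hist_of (x, h1, take (t - 1) recs) i)"

definition Uv :: "'i \<Rightarrow> nat \<Rightarrow> ('x,'i,'h,'u,'z) traj \<Rightarrow> 'u" where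
  "Uv i t s = (case s of (x, h1, recs) \<Rightarrow> fst (recs ! (t - 1)) i)"

definition Rv :: "'i \<Rightarrow> nat \<Rightarrow> ('x,'i,'h,'u,'z) traj \<Rightarrow> real" where
  "Rv i t s = (case s of (x, h1, recs) \<Rightarrow> snd (snd (recs ! (t - 1))) i)"

definition payoff where
  "payoff f mu0 Wd T g i =
     measure_pmf.expectation (traj f mu0 Wd g T) (\<lambda>s. \<Sum>t\<in>{1..T}. Rv i t s)"

definition is_bstrat :: "(nat \<Rightarrow> 'i \<Rightarrow> 'u set) \<Rightarrow> nat \<Rightarrow> 'i \<Rightarrow> ('h,'u,'z) bstrat \<Rightarrow> bool" where
  "is_bstrat Uset T i gi \<longleftrightarrow> (\<forall>t\<in>{1..T}. \<forall>h. set_pmf (gi t h) \<subseteq> Uset t i)"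

text \<open>compression: K_1 = iota1 H_1, K_{t} = iota t K_{t-1} Z_{t-1}\<close>
primrec kseq :: "('i \<Rightarrow> 'h \<Rightarrow> 'k) \<Rightarrow> (nat \<Rightarrow> 'i \<Rightarrow> 'k \<Rightarrow> ('u \<times> 'z) \<Rightarrow> 'k)
    \<Rightarrow> 'i \<Rightarrow> 'h \<Rightarrow> ('u \<times> 'z) list \<Rightarrow> nat \<Rightarrow> 'k" where
  "kseq iota1 iota i h1 zs 0 = iota1 i h1"
| "kseq iota1 iota i h1 zs (Suc n) = iota (Suc (Suc n)) i (kseq iota1 iota i h1 zs n) (zs ! n)"

text \<open>compression k_t^i of a history h_t^i (of length t-1)\<close>
definition kcomp :: "('i \<Rightarrow> 'h \<Rightarrow> 'k) \<Rightarrow> (nat \<Rightarrow> 'i \<Rightarrow> 'k \<Rightarrow> ('u \<times> 'z) \<Rightarrow> 'k)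
    \<Rightarrow> 'i \<Rightarrow> ('h,'u,'z) hist \<Rightarrow> 'k" where
  "kcomp iota1 iota i h = (case h of (h1, zs) \<Rightarrow> kseq iota1 iota i h1 zs (length zs))"

definition is_kstrat :: "(nat \<Rightarrow> 'i \<Rightarrow> 'u set) \<Rightarrow> nat \<Rightarrow> 'i \<Rightarrow> ('k,'u) kstrat \<Rightarrow> bool" where
  "is_kstrat Uset T i rho \<longleftrightarrow> (\<forall>t\<in>{1..T}. \<forall>k. set_pmf (rho t k) \<subseteq> Uset t i)"

definition induced :: "('i \<Rightarrow> 'h \<Rightarrow> 'k) \<Rightarrow> (nat \<Rightarrow> 'i \<Rightarrow> 'k \<Rightarrow> ('u \<times> 'z) \<Rightarrow> 'k)
    \<Rightarrow> ('i \<Rightarrow> ('k,'u) kstrat) \<Rightarrow> 'i \<Rightarrow> ('h,'u,'z) bstrat" where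
  "induced iota1 iota rho i = (\<lambda>t h. rho i t (kcomp iota1 iota i h))"

text \<open>K^i is an information state under g^{-i} (the i-th component of g is ignored).
  (h,u) is admissible under (g^i,g^{-i}) iff Pr(H_t^i = h, U_t^i = u) > 0; conditional
  probabilities/expectations are the elementary ratios.\<close>
definition info_state where
  "info_state f mu0 Wd T Uset iota1 iota i g \<longleftrightarrow>
     (\<exists>P :: nat \<Rightarrow> 'k \<Rightarrow> 'u \<Rightarrow> 'k pmf. \<exists>r :: nat \<Rightarrow> 'k \<Rightarrow> 'u \<Rightarrow> real.
        (\<forall>t k u. r t k u \<in> {-1..1}) \<and>
        (\<forall>gi. is_bstrat Uset T i gi \<longrightarrow>
          (let D = traj f mu0 Wd (g(i := gi)) T in
           \<forall>t\<in>{1..T}. \<forall>h u.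
             let pHU = measure_pmf.prob D {s. Hv i t s = h \<and> Uv i t s = u} in
             pHU > 0 \<longrightarrow>
               ((t < T \<longrightarrow> (\<forall>k'.
                   measure_pmf.prob D {s. Hv i t s = h \<and> Uv i t s = u \<and>
                       kcomp iota1 iota i (Hv i (t + 1) s) = k'} / pHU
                   = pmf (P t (kcomp iota1 iota i h) u) k')) \<and>
                measure_pmf.expectation D
                   (\<lambda>s. if Hv i t s = h \<and> Uv i t s = u then Rv i t s else 0) / pHU
                   = r t (kcomp iota1 iota i h) u))))"

definition MSI where
  "MSI f mu0 Wd T Uset iota1 iota \<longleftrightarrow>
     (\<forall>i. \<forall>rho. (\<forall>j. is_kstrat Uset T j (rho j)) \<longrightarrow>
        info_state f mu0 Wd T Uset iota1 iota i (induced iota1 iota rho))"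

end

(*
  Restrict the players to compressed strategies in which every action has a positive minimal
  probability, and let every triple (player, time, compressed state) be an agent. The agents' game
  has a Nash equilibrium by Brouwer's theorem. Mutually sufficient information makes the problem of
  each player, against compressed strategies of the others, a Markov decision process on the
  compressed states, so the performance difference formula holds for arbitrary full-history
  deviations. Since all reachable compressed states are reached under the trembling profile,
  optimality of every agent implies optimality of every player against trembling full-history
  strategies. A limit point for vanishing trembles is the equilibrium, because payoffs are
  continuous in the action probabilities.
*)

theory Submission
  imports Defs
begin

section \<open>A Nash map on products of simplices\<close>

text \<open>Without trembles, the agent at a compressed state of probability zero has a payoff that
  does not depend on its own action. Nash play of the agents may then be arbitrary there, and a
  player who deviates at several states at once could reach such a state and profit, although no
  single agent could. A second obstacle is that MSI supplies the kernels \<open>P\<close> and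
  \<open>r\<close> separately for each profile of the other players and constrains them only at
  admissible histories, so nothing is known about their continuity in the profile. Hence the kernels
  are used for one fixed profile at a time, and the limits, both in the Nash map and for vanishing
  trembles, are limits of payoffs, which are polynomials in the action probabilities. Nash's map is
  single-valued, so Brouwer's theorem suffices and no set-valued fixed point theorem enters.\<close>

lemma finite_index_seq_compact:
  fixes X :: "nat \<Rightarrow> 'b \<Rightarrow> real"
  assumes "finite B" and "\<And>n b. b \<in> B \<Longrightarrow> X n b \<in> {0..1}"
  obtains r x where "strict_mono (r :: nat \<Rightarrow> nat)" "\<And>b. b \<in> B \<Longrightarrow> (\<lambda>n. X (r n) b) \<longlonglongrightarrow> x b"
    "\<And>b. b \<in> B \<Longrightarrow> x b \<in> {0..1}"
proof -
  have "\<exists>r x. strict_mono (r :: nat \<Rightarrow> nat) \<and> (\<forall>b\<in>B. (\<lambda>n. X (r n) b) \<longlonglongrightarrow> x b)"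
    using assms
  proof (induction B rule: finite_induct)
    case empty
    then show ?case by (auto intro!: exI[of _ id] simp: strict_mono_def)
  next
    case (insert c B)
    then obtain r x where r: "strict_mono (r :: nat \<Rightarrow> nat)" "\<forall>b\<in>B. (\<lambda>n. X (r n) b) \<longlonglongrightarrow> x b"
      by auto
    have "bounded (range (\<lambda>n. X (r n) c))"
      by (rule boundedI[of _ 1]) (use insert.prems in fastforce)
    then obtain l r' where r': "strict_mono (r' :: nat \<Rightarrow> nat)" "((\<lambda>n. X (r n) c) \<circ> r') \<longlonglongrightarrow> l"
      using bounded_imp_convergent_subsequence by blast
    have "(\<lambda>n. X ((r \<circ> r') n) b) \<longlonglongrightarrow> (x(c := l)) b" if "b \<in> insert c B" for b
    proof (cases "b = c")
      case True
      then show ?thesis using r'(2) by (simp add: o_def)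
    next
      case False
      then have "(\<lambda>n. X (r n) b) \<longlonglongrightarrow> x b" using that r(2) by auto
      from LIMSEQ_subseq_LIMSEQ[OF this r'(1)] show ?thesis
        using False by (simp add: o_def)
    qed
    then show ?case
      using strict_mono_o[OF r(1) r'(1)] by blast
  qed
  then obtain r x where rx: "strict_mono (r :: nat \<Rightarrow> nat)" "\<And>b. b \<in> B \<Longrightarrow> (\<lambda>n. X (r n) b) \<longlonglongrightarrow> x b"
    by blast
  moreover have "x b \<in> {0..1}" if "b \<in> B" for b
    using closed_sequentially[OF closed_atLeastAtMost _ rx(2)[OF that]] assms(2)[OF that] by blast
  ultimately show ?thesis using that by blast
qed

text \<open>The dimension is a term here, so the library's version for the type class
  \<open>euclidean_space\<close> does not apply; Kuhn's combinatorial lemma does.\<close>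

lemma brouwer_nat_cube:
  fixes f :: "(nat \<Rightarrow> real) \<Rightarrow> nat \<Rightarrow> real"
  assumes cube: "\<And>x i. (\<forall>j<n. x j \<in> {0..1}) \<Longrightarrow> i < n \<Longrightarrow> f x i \<in> {0..1}"
    and cont: "\<And>X x i. (\<forall>m. \<forall>j<n. X m j \<in> {0..1}) \<Longrightarrow> (\<forall>j<n. x j \<in> {0..1}) \<Longrightarrow>
      (\<forall>j<n. (\<lambda>m::nat. X m j) \<longlonglongrightarrow> x j) \<Longrightarrow> i < n \<Longrightarrow> (\<lambda>m. f (X m) i) \<longlonglongrightarrow> f x i"
  obtains x where "\<forall>i<n. x i \<in> {0..1}" "\<forall>i<n. f x i = x i"
proof -
  define P where "P = (\<lambda>x :: nat \<Rightarrow> real. \<forall>i<n. x i \<in> {0..1})"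
  \<comment> \<open>Label 0 marks a coordinate that \<open>f\<close> does not decrease, label 1 one
    that it does not increase. On the faces of the cube the label is forced as Kuhn's lemma demands,
    and there \<open>cube\<close> makes this reading true.\<close>
  define l where "l = (\<lambda>x i. if x i = 0 \<or> (x i \<noteq> 1 \<and> x i \<le> f x i) then 0 else 1 :: nat)"
  have l: "l x i \<le> 1" "x i = 0 \<Longrightarrow> l x i = 0" "x i = 1 \<Longrightarrow> l x i = 1" for x i
    by (simp_all add: l_def)
  have l': "P x \<Longrightarrow> i < n \<Longrightarrow> l x i = 0 \<Longrightarrow> x i \<le> f x i"
      "P x \<Longrightarrow> i < n \<Longrightarrow> l x i = 1 \<Longrightarrow> f x i \<le> x i" for x i
    using cube[of x i] by (auto simp: l_def P_def split: if_splits)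
  \<comment> \<open>The integer grid with side \<open>Suc p\<close> is scaled to the unit cube; the
    successor keeps the mesh defined at \<open>p = 0\<close>.\<close>
  define sc where "sc = (\<lambda>p (x :: nat \<Rightarrow> nat) i. real (x i) / real (Suc p))"
  have P_sc: "P (sc p x)" if "\<forall>i<n. x i \<le> Suc p" for p x
    using that by (auto simp: P_def sc_def divide_le_eq)
  have grid: "\<exists>q. (\<forall>i<n. q i < Suc p) \<and> (\<forall>i<n. \<exists>r s. (\<forall>j<n. q j \<le> r j \<and> r j \<le> q j + 1) \<and>
      (\<forall>j<n. q j \<le> s j \<and> s j \<le> q j + 1) \<and> l (sc p r) i = 0 \<and> l (sc p s) i = 1)" for p
  proof -
    have "l y i = 0 \<or> l y i = 1" for y i using l(1)[of y i] by linarith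
    then have lab: "\<forall>x. (\<forall>i<n. x i \<le> Suc p) \<longrightarrow> (\<forall>i<n. l (sc p x) i = 0 \<or> l (sc p x) i = 1)"
      by blast
    have lab0: "\<forall>x. (\<forall>i<n. x i \<le> Suc p) \<longrightarrow> (\<forall>i<n. x i = 0 \<longrightarrow> l (sc p x) i = 0)"
      by (intro allI impI l(2)) (auto simp: sc_def)
    have lab1: "\<forall>x. (\<forall>i<n. x i \<le> Suc p) \<longrightarrow> (\<forall>i<n. x i = Suc p \<longrightarrow> l (sc p x) i = 1)"
      by (intro allI impI l(3)) (auto simp: sc_def simp del: of_nat_Suc)
    obtain q where q: "\<forall>i<n. q i < Suc p" and
      rs: "\<forall>i<n. \<exists>r s. (\<forall>j<n. q j \<le> r j \<and> r j \<le> q j + 1) \<and> (\<forall>j<n. q j \<le> s j \<and> s j \<le> q j + 1) \<and>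
        l (sc p r) i \<noteq> l (sc p s) i"
      using kuhn_lemma[of "Suc p" n "\<lambda>x. l (sc p x)", OF zero_less_Suc lab lab0 lab1] by metis
    have dich: "a = 0 \<and> b = 1 \<or> a = 1 \<and> b = 0" if "a \<noteq> b" "a \<le> 1" "b \<le> 1" for a b :: nat
      using that by linarith
    show ?thesis
    proof (rule exI[of _ q], rule conjI[OF q], intro allI impI)
      fix i assume "i < n"
      then obtain r s where *: "\<forall>j<n. q j \<le> r j \<and> r j \<le> q j + 1" "\<forall>j<n. q j \<le> s j \<and> s j \<le> q j + 1"
        "l (sc p r) i \<noteq> l (sc p s) i" using rs by blast
      from dich[OF *(3) l(1) l(1)] *(1,2)
      show "\<exists>r s. (\<forall>j<n. q j \<le> r j \<and> r j \<le> q j + 1) \<and>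
        (\<forall>j<n. q j \<le> s j \<and> s j \<le> q j + 1) \<and> l (sc p r) i = 0 \<and> l (sc p s) i = 1"
        by blast
    qed
  qed
  then obtain q where q: "\<And>p i. i < n \<Longrightarrow> q p i < Suc p" and
    rs: "\<And>p i. i < n \<Longrightarrow> \<exists>r s. (\<forall>j<n. q p j \<le> r j \<and> r j \<le> q p j + 1) \<and>
      (\<forall>j<n. q p j \<le> s j \<and> s j \<le> q p j + 1) \<and> l (sc p r) i = 0 \<and> l (sc p s) i = 1"
    by metis
  have q01: "sc p (q p) j \<in> {0..1}" if "j < n" for p j
    using q[OF that, of p] by (auto simp: sc_def divide_le_eq)
  obtain r x where r: "strict_mono (r :: nat \<Rightarrow> nat)"
    and x: "\<And>j. j \<in> {..<n} \<Longrightarrow> (\<lambda>m. sc (r m) (q (r m)) j) \<longlonglongrightarrow> x j" "\<And>j. j \<in> {..<n} \<Longrightarrow> x j \<in> {0..1}"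
    by (rule finite_index_seq_compact[of "{..<n}" "\<lambda>m. sc m (q m)"]) (use q01 in auto)
  \<comment> \<open>A vertex of the cell at \<open>q\<close> differs from \<open>q\<close> by at
    most one mesh width in each coordinate, so any choice of vertices has the same limit
    \<open>x\<close>.\<close>
  have near: "(\<lambda>m. sc (r m) (v m) j) \<longlonglongrightarrow> x j"
    if v: "\<And>m j. j < n \<Longrightarrow> q (r m) j \<le> v m j \<and> v m j \<le> q (r m) j + 1" and j: "j < n" for v j
  proof (rule Lim_transform[OF x(1)])
    show "j \<in> {..<n}" using j by simp
    have "(\<lambda>m. sc (r m) (q (r m)) j - sc (r m) (v m) j) \<longlonglongrightarrow> 0"
    proof (rule Lim_null_comparison)
      have "\<bar>sc (r m) (q (r m)) j - sc (r m) (v m) j\<bar> \<le> 1 / real (Suc (r m))" for m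
      proof -
        have "\<bar>real (q (r m) j) - real (v m j)\<bar> \<le> 1" using v[OF j, of m] by linarith
        then show ?thesis
          by (simp add: sc_def divide_right_mono flip: diff_divide_distrib)
      qed
      then show "\<forall>\<^sub>F m in sequentially. norm (sc (r m) (q (r m)) j - sc (r m) (v m) j) \<le> 1 / real (Suc (r m))"
        by simp
      have "(\<lambda>m. 1 / real (Suc m)) \<longlonglongrightarrow> 0"
        using LIMSEQ_inverse_real_of_nat by (simp add: inverse_eq_divide)
      from LIMSEQ_subseq_LIMSEQ[OF this r]
      show "(\<lambda>m. 1 / real (Suc (r m))) \<longlonglongrightarrow> 0" by (simp add: o_def)
    qed
    then show "(\<lambda>m. sc (r m) (v m) j - sc (r m) (q (r m)) j) \<longlonglongrightarrow> 0"
      using tendsto_minus by fastforce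
  qed
  have Pv: "P (sc (r m) (v m))"
    if v: "\<And>m j. j < n \<Longrightarrow> q (r m) j \<le> v m j \<and> v m j \<le> q (r m) j + 1" for v m
    by (rule P_sc) (use v[of _ m] q[of _ "r m"] in fastforce)
  have Px: "P x" using x(2) by (auto simp: P_def)
  \<comment> \<open>Each cell has a vertex with label 0 and one with label 1 in coordinate
    \<open>i\<close>. Both vertex sequences converge to \<open>x\<close>, and their opposite
    inequalities meet in the limit.\<close>
  have "f x i = x i" if i: "i < n" for i
  proof -
    have "\<forall>m. \<exists>a b. (\<forall>j<n. q (r m) j \<le> a j \<and> a j \<le> q (r m) j + 1) \<and>
      (\<forall>j<n. q (r m) j \<le> b j \<and> b j \<le> q (r m) j + 1) \<and> l (sc (r m) a) i = 0 \<and> l (sc (r m) b) i = 1"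
      using rs[OF i] by blast
    then obtain a b where ab: "\<And>m j. j < n \<Longrightarrow> q (r m) j \<le> a m j \<and> a m j \<le> q (r m) j + 1"
      "\<And>m j. j < n \<Longrightarrow> q (r m) j \<le> b m j \<and> b m j \<le> q (r m) j + 1"
      "\<And>m. l (sc (r m) (a m)) i = 0" "\<And>m. l (sc (r m) (b m)) i = 1"
      by metis
    have "(\<lambda>m. f (sc (r m) (a m)) i) \<longlonglongrightarrow> f x i" "(\<lambda>m. f (sc (r m) (b m)) i) \<longlonglongrightarrow> f x i"
      using Pv[OF ab(1)] Pv[OF ab(2)] Px near[OF ab(1)] near[OF ab(2)] i
      by (auto intro!: cont simp: P_def)
    moreover have "sc (r m) (a m) i \<le> f (sc (r m) (a m)) i" "f (sc (r m) (b m)) i \<le> sc (r m) (b m) i" for m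
      by (rule l'; use Pv[OF ab(1)] Pv[OF ab(2)] ab i in simp)+
    ultimately show ?thesis
      using LIMSEQ_le[OF near[OF ab(1) i], of _ "f x i"] LIMSEQ_le[OF _ near[OF ab(2) i], of _ "f x i"]
      by (intro antisym) blast+
  qed
  then show ?thesis using Px that by (auto simp: P_def)
qed

text \<open>The cube is transported along an enumeration of \<open>B\<close>. Points are functions
  on the whole type; \<open>cont\<close>, applied to constant sequences, also forces
  \<open>f\<close> to ignore the coordinates outside \<open>B\<close>.\<close>

lemma brouwer_finite_cube:
  fixes f :: "('b \<Rightarrow> real) \<Rightarrow> 'b \<Rightarrow> real"
  assumes "finite B"
    and cube: "\<And>x b. (\<forall>c\<in>B. x c \<in> {0..1}) \<Longrightarrow> b \<in> B \<Longrightarrow> f x b \<in> {0..1}"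
    and cont: "\<And>X x b. (\<forall>m. \<forall>c\<in>B. X m c \<in> {0..1}) \<Longrightarrow> (\<forall>c\<in>B. x c \<in> {0..1}) \<Longrightarrow>
      (\<forall>c\<in>B. (\<lambda>m::nat. X m c) \<longlonglongrightarrow> x c) \<Longrightarrow> b \<in> B \<Longrightarrow> (\<lambda>m. f (X m) b) \<longlonglongrightarrow> f x b"
  obtains x where "\<forall>b\<in>B. x b \<in> {0..1}" "\<forall>b\<in>B. f x b = x b"
proof -
  obtain e where e: "bij_betw e B {..<card B}"
    using ex_bij_betw_finite_nat[OF \<open>finite B\<close>] by (auto simp: atLeast0LessThan)
  define d where "d = inv_into B e"
  have de: "d (e b) = b" "e b < card B" if "b \<in> B" for b
    using e that by (auto simp: d_def bij_betw_def)
  have dB: "d j \<in> B" "e (d j) = j" if "j < card B" for j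
    using e that by (auto simp: d_def bij_betw_def inv_into_into f_inv_into_f)
  obtain x where x: "\<forall>i<card B. x i \<in> {0..1}" "\<forall>i<card B. f (\<lambda>b. x (e b)) (d i) = x i"
  proof (rule brouwer_nat_cube[of "card B" "\<lambda>x i. f (\<lambda>b. x (e b)) (d i)"])
    fix x i assume "\<forall>j<card B. x j \<in> {0..1::real}" "i < card B"
    then show "f (\<lambda>b. x (e b)) (d i) \<in> {0..1}"
      by (intro cube) (auto simp: de dB)
  next
    fix X x i assume "\<forall>m. \<forall>j<card B. X m j \<in> {0..1::real}" "\<forall>j<card B. x j \<in> {0..1}"
      "\<forall>j<card B. (\<lambda>m::nat. X m j) \<longlonglongrightarrow> x j" "i < card B"
    then show "(\<lambda>m. f (\<lambda>b. X m (e b)) (d i)) \<longlonglongrightarrow> f (\<lambda>b. x (e b)) (d i)"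
      by (intro cont) (auto simp: de dB)
  qed auto
  show ?thesis
    by (rule that[of "\<lambda>b. x (e b)"]) (use x de in force)+
qed

section \<open>Simplices as retracts, and Nash's map\<close>

definition simplex_on :: "'u::finite set \<Rightarrow> ('u \<Rightarrow> real) set" where
  "simplex_on S = {q. (\<forall>u. 0 \<le> q u) \<and> (\<forall>u. u \<notin> S \<longrightarrow> q u = 0) \<and> sum q UNIV = 1}"

lemma simplex_on_le_1: "q \<in> simplex_on S \<Longrightarrow> q u \<le> 1"
  using member_le_sum[of u UNIV q] by (auto simp: simplex_on_def)

lemma simplex_onD:
  assumes "q \<in> simplex_on S"
  shows "0 \<le> q u" "u \<notin> S \<Longrightarrow> q u = 0" "sum q UNIV = 1" "sum q S = 1"
proof -
  show "0 \<le> q u" "u \<notin> S \<Longrightarrow> q u = 0" "sum q UNIV = 1"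
    using assms by (auto simp: simplex_on_def)
  then show "sum q S = 1"
    using assms sum.mono_neutral_right[of UNIV S q] by (auto simp: simplex_on_def)
qed

text \<open>A retraction of the nonnegative orthant onto the simplex: missing mass is spread uniformly,
  excess mass is scaled away.\<close>

definition simplex_retract :: "'u::finite set \<Rightarrow> ('u \<Rightarrow> real) \<Rightarrow> 'u \<Rightarrow> real" where
  "simplex_retract S x u = (if u \<in> S
     then (x u + max 0 (1 - sum x S) / real (card S)) / max 1 (sum x S) else 0)"

lemma simplex_retract_in:
  assumes "S \<noteq> {}" "\<And>u. u \<in> S \<Longrightarrow> 0 \<le> x u"
  shows "simplex_retract S x \<in> simplex_on S"
proof -
  have c: "real (card S) \<noteq> 0" using assms(1) by simp
  have "sum (simplex_retract S x) UNIV = sum (simplex_retract S x) S"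
    by (rule sum.mono_neutral_right) (auto simp: simplex_retract_def)
  also have "\<dots> = (sum x S + max 0 (1 - sum x S)) / max 1 (sum x S)"
    using c by (simp add: simplex_retract_def sum.distrib del: sum.neutral_const flip: sum_divide_distrib)
  also have "\<dots> = 1" by (auto simp: max_def)
  finally show ?thesis
    using assms(2) by (auto simp: simplex_on_def simplex_retract_def intro!: divide_nonneg_nonneg add_nonneg_nonneg)
qed

lemma simplex_retract_id:
  assumes "\<And>u. u \<in> S \<Longrightarrow> x u = q u" "q \<in> simplex_on S"
  shows "simplex_retract S x = q"
proof -
  have "sum x S = 1" using simplex_onD(4)[OF assms(2)] assms(1) by simp
  then show ?thesis
    using assms(1) simplex_onD(2)[OF assms(2)] by (auto simp: simplex_retract_def)
qed

text \<open>Nash's argument: weight moves toward actions that beat the current average. At a fixed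
  point the gains are proportional to \<open>q a\<close>; if their sum were positive, every action
  in the support would strictly beat the average of those same actions. \<open>G\<close> may be any
  continuous function here; that the average is itself a payoff is established only for the
  game.\<close>

lemma nash_map_fixed_point:
  fixes G :: "('a \<Rightarrow> 'u::finite \<Rightarrow> real) \<Rightarrow> 'a \<Rightarrow> 'u \<Rightarrow> real"
  assumes "finite A" and S: "\<And>a. a \<in> A \<Longrightarrow> S a \<noteq> {}"
    and cont: "\<And>X x a u. (\<forall>m. \<forall>b\<in>A. X m b \<in> simplex_on (S b)) \<Longrightarrow> (\<forall>b\<in>A. x b \<in> simplex_on (S b)) \<Longrightarrow>
      (\<forall>b\<in>A. \<forall>v. (\<lambda>m::nat. X m b v) \<longlonglongrightarrow> x b v) \<Longrightarrow> a \<in> A \<Longrightarrow> (\<lambda>m. G (X m) a u) \<longlonglongrightarrow> G x a u"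
  obtains q where "\<And>a. a \<in> A \<Longrightarrow> q a \<in> simplex_on (S a)"
    "\<And>a u. a \<in> A \<Longrightarrow> u \<in> S a \<Longrightarrow> G q a u \<le> (\<Sum>v\<in>UNIV. q a v * G q a v)"
proof -
  define avg where "avg = (\<lambda>q a. \<Sum>v\<in>UNIV. q a v * G q a v)"
  define gain where "gain = (\<lambda>q a u. if u \<in> S a then max 0 (G q a u - avg q a) else 0)"
  define N where "N = (\<lambda>q a u. (q a u + gain q a u) / (1 + sum (gain q a) UNIV))"
  \<comment> \<open>Brouwer's theorem is available on cubes, so \<open>N\<close> is composed with a
    retraction of the cube onto the product of simplices.\<close>
  define ret where "ret = (\<lambda>(x :: 'a \<times> 'u \<Rightarrow> real) a. simplex_retract (S a) (\<lambda>u. x (a, u)))"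
  have gain0: "0 \<le> gain q a u" for q a u by (simp add: gain_def)
  have gainsum: "0 \<le> sum (gain q a) UNIV" for q a by (simp add: gain0 sum_nonneg)
  have N_in: "N q a \<in> simplex_on (S a)" if q: "q a \<in> simplex_on (S a)" for q a
  proof -
    have "sum (N q a) UNIV = (sum (q a) UNIV + sum (gain q a) UNIV) / (1 + sum (gain q a) UNIV)"
      by (simp add: N_def sum.distrib flip: sum_divide_distrib)
    then have "sum (N q a) UNIV = 1"
      using simplex_onD(3)[OF q] gainsum[of q a] by simp
    then show ?thesis
      using simplex_onD(1,2)[OF q] gain0[of q a] gainsum[of q a]
      by (auto simp: simplex_on_def N_def gain_def)
  qed
  have ret_in: "ret x a \<in> simplex_on (S a)" if "\<forall>b\<in>A \<times> UNIV. x b \<in> {0..1}" "a \<in> A" for x a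
    unfolding ret_def by (rule simplex_retract_in) (use that S in auto)
  obtain x where x: "\<forall>b\<in>A \<times> UNIV. x b \<in> {0..1}" "\<forall>b\<in>A \<times> UNIV. N (ret x) (fst b) (snd b) = x b"
  proof (rule brouwer_finite_cube[of "A \<times> UNIV" "\<lambda>x b. N (ret x) (fst b) (snd b)"])
    show "finite (A \<times> (UNIV :: 'u set))" using \<open>finite A\<close> by simp
    fix x :: "'a \<times> 'u \<Rightarrow> real" and b :: "'a \<times> 'u"
    assume "\<forall>b\<in>A \<times> UNIV. x b \<in> {0..1}" "b \<in> A \<times> UNIV"
    then have "N (ret x) (fst b) \<in> simplex_on (S (fst b))"
      by (intro N_in ret_in) auto
    then show "N (ret x) (fst b) (snd b) \<in> {0..1}"
      using simplex_onD(1) simplex_on_le_1 by auto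
  next
    fix X :: "nat \<Rightarrow> 'a \<times> 'u \<Rightarrow> real" and x :: "'a \<times> 'u \<Rightarrow> real" and b :: "'a \<times> 'u"
    assume X: "\<forall>m. \<forall>b\<in>A \<times> UNIV. X m b \<in> {0..1}" and x: "\<forall>b\<in>A \<times> UNIV. x b \<in> {0..1}"
      and lim: "\<forall>b\<in>A \<times> UNIV. (\<lambda>m. X m b) \<longlonglongrightarrow> x b" and b: "b \<in> A \<times> UNIV"
    have ret_lim: "(\<lambda>m. ret (X m) a u) \<longlonglongrightarrow> ret x a u" if "a \<in> A" for a u
    proof -
      have "max 1 y \<noteq> (0::real)" for y by linarith
      moreover have "card (S a) \<noteq> 0" using S[OF that] by simp
      ultimately show ?thesis
        unfolding ret_def simplex_retract_def using lim that by (auto intro!: tendsto_intros)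
    qed
    have G_lim: "(\<lambda>m. G (ret (X m)) a u) \<longlonglongrightarrow> G (ret x) a u" if "a \<in> A" for a u
      by (rule cont) (use X x ret_in ret_lim that in auto)
    have gain_lim: "(\<lambda>m. gain (ret (X m)) a u) \<longlonglongrightarrow> gain (ret x) a u" if "a \<in> A" for a u
      unfolding gain_def avg_def by (auto intro!: tendsto_intros ret_lim G_lim that)
    show "(\<lambda>m. N (ret (X m)) (fst b) (snd b)) \<longlonglongrightarrow> N (ret x) (fst b) (snd b)"
      unfolding N_def using b gainsum[of "ret x" "fst b"]
      by (auto intro!: tendsto_intros ret_lim gain_lim)
  qed auto
  define q where "q = ret x"
  have q: "q a \<in> simplex_on (S a)" if "a \<in> A" for a
    unfolding q_def by (rule ret_in[OF x(1) that])
  \<comment> \<open>The fixed point \<open>x\<close> of the composed map agrees with values of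
    \<open>N\<close>, which lie in the simplices already. The retraction therefore leaves
    \<open>x\<close> unchanged, and \<open>q\<close> is fixed by \<open>N\<close> itself.\<close>
  have fixp: "N q a = q a" if "a \<in> A" for a
  proof -
    have "simplex_retract (S a) (\<lambda>u. x (a, u)) = N q a"
      by (rule simplex_retract_id) (use x(2) that N_in[of q a, OF q] in \<open>auto simp: q_def\<close>)
    then show ?thesis by (simp add: q_def ret_def)
  qed
  have "G q a u \<le> avg q a" if a: "a \<in> A" and u: "u \<in> S a" for a u
  proof -
    define s where "s = sum (gain q a) UNIV"
    have s0: "s \<ge> 0" using gainsum by (simp add: s_def)
    have eq: "q a v * s = gain q a v" for v
    proof -
      have "(q a v + gain q a v) / (1 + s) = q a v"
        using fun_cong[OF fixp[OF a], of v] by (simp add: N_def s_def)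
      then show ?thesis using s0 by (simp add: field_simps)
    qed
    have "s = 0"
    proof (rule ccontr)
      assume "s \<noteq> 0"
      then have s: "s > 0" using s0 by simp
      have le: "q a v * avg q a \<le> q a v * G q a v" for v
      proof (cases "q a v = 0")
        case False
        then have "gain q a v > 0"
          using eq[of v] s simplex_onD(1)[OF q[OF a], of v] by (metis mult_pos_pos order_less_le)
        then have "avg q a \<le> G q a v" by (auto simp: gain_def split: if_splits)
        then show ?thesis using simplex_onD(1)[OF q[OF a]] by (simp add: mult_left_mono)
      qed simp
      obtain w where w: "q a w > 0"
        using simplex_onD(1,3)[OF q[OF a]] by (metis less_eq_real_def sum.neutral zero_neq_one)
      then have "gain q a w > 0" using eq[of w] s by (metis mult_pos_pos)
      then have "avg q a < G q a w" by (auto simp: gain_def max_def split: if_splits)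
      then have "(\<Sum>v\<in>UNIV. q a v * avg q a) < (\<Sum>v\<in>UNIV. q a v * G q a v)"
        using w le by (intro sum_strict_mono_ex1) (auto intro!: exI[of _ w] mult_strict_left_mono)
      then show False
        using simplex_onD(3)[OF q[OF a]] by (simp add: avg_def flip: sum_distrib_right)
    qed
    then have "gain q a u = 0" using eq[of u] by simp
    then show ?thesis using u by (auto simp: gain_def split: if_splits)
  qed
  then show ?thesis using that[of q] q by (simp add: avg_def)
qed

section \<open>Trembling actions\<close>

lemma pmf_embed_simplex:
  assumes "q \<in> simplex_on S"
  shows "pmf (embed_pmf q) u = q u"
proof (rule pmf_embed_pmf)
  show "0 \<le> q u" for u by (rule simplex_onD(1)[OF assms])
  have "(\<integral>\<^sup>+ u. ennreal (q u) \<partial>count_space UNIV) = ennreal (sum q UNIV)"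
    using simplex_onD(1)[OF assms] by (simp add: nn_integral_count_space_finite sum_ennreal)
  then show "(\<integral>\<^sup>+ u. ennreal (q u) \<partial>count_space UNIV) = 1"
    by (simp add: simplex_onD(3)[OF assms])
qed

lemma pmf_in_simplex_on: "set_pmf p \<subseteq> S \<Longrightarrow> pmf p \<in> simplex_on S"
  by (auto simp: simplex_on_def set_pmf_eq intro!: sum_pmf_eq_1)

text \<open>A mixture of \<open>q\<close> with the uniform distribution on \<open>S\<close>. It is
  affine in \<open>q\<close>, so the Nash map can run on the full simplices while each action in
  \<open>S\<close> keeps probability at least \<open>\<epsilon> / card S\<close>.\<close>

definition tremble :: "real \<Rightarrow> 'u::finite set \<Rightarrow> ('u \<Rightarrow> real) \<Rightarrow> 'u pmf" where
  "tremble \<epsilon> S q = embed_pmf (\<lambda>u. (1 - \<epsilon>) * q u + (if u \<in> S then \<epsilon> / card S else 0))"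

context
  fixes \<epsilon> :: real and S :: "'u::finite set" and q :: "'u \<Rightarrow> real"
  assumes \<epsilon>: "0 < \<epsilon>" "\<epsilon> \<le> 1" and q: "q \<in> simplex_on S"
begin

lemma pmf_tremble: "pmf (tremble \<epsilon> S q) u = (1 - \<epsilon>) * q u + (if u \<in> S then \<epsilon> / card S else 0)"
proof -
  have "S \<noteq> {}" using simplex_onD(4)[OF q] by auto
  then have "(\<lambda>u. (1 - \<epsilon>) * q u + (if u \<in> S then \<epsilon> / card S else 0)) \<in> simplex_on S"
    using \<epsilon> simplex_onD[OF q]
    by (auto simp: simplex_on_def sum.distrib sum.If_cases simp flip: sum_distrib_left)
  then show ?thesis unfolding tremble_def by (rule pmf_embed_simplex)
qed

lemma set_tremble: "set_pmf (tremble \<epsilon> S q) = S"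
proof -
  have "0 < (1 - \<epsilon>) * q u + \<epsilon> / card S" if "u \<in> S" for u
    using that \<epsilon> simplex_onD(1)[OF q] by (intro add_nonneg_pos) (auto intro!: divide_pos_pos simp: card_gt_0_iff)
  then have "pmf (tremble \<epsilon> S q) u \<noteq> 0 \<longleftrightarrow> u \<in> S" for u
    using simplex_onD(2)[OF q, of u] by (cases "u \<in> S") (force simp: pmf_tremble)+
  then show ?thesis by (simp add: set_pmf_eq)
qed

end

definition unit_vec :: "'u \<Rightarrow> 'u \<Rightarrow> real" where
  "unit_vec u = (\<lambda>v. if v = u then 1 else 0)"

lemma unit_vec_in_simplex_on: "u \<in> S \<Longrightarrow> unit_vec u \<in> simplex_on S"
  by (auto simp: simplex_on_def unit_vec_def)

text \<open>\<open>tremble\<close> is affine and \<open>q\<close> is the barycentre of the unit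
  vectors with weights \<open>q u\<close>. The uniform part contributes the constant
  \<open>C\<close> to every pure action and, since the weights sum to 1, once in total. This links
  the average in the Nash map to the payoff of the trembling mixture.\<close>

lemma sum_tremble:
  fixes B :: "'u::finite \<Rightarrow> real"
  assumes \<epsilon>: "0 < \<epsilon>" "\<epsilon> \<le> 1" and q: "q \<in> simplex_on S"
  shows "(\<Sum>v\<in>UNIV. pmf (tremble \<epsilon> S q) v * B v) =
    (\<Sum>u\<in>UNIV. q u * (\<Sum>v\<in>UNIV. pmf (tremble \<epsilon> S (unit_vec u)) v * B v))"
proof -
  define C where "C = (\<Sum>v\<in>UNIV. (if v \<in> S then \<epsilon> / card S else 0) * B v)"
  have expand: "(\<Sum>v\<in>UNIV. pmf (tremble \<epsilon> S p) v * B v) = (1 - \<epsilon>) * (\<Sum>v\<in>UNIV. p v * B v) + C"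
    if "p \<in> simplex_on S" for p
    by (simp add: pmf_tremble[OF \<epsilon> that] distrib_right sum.distrib C_def sum_distrib_left mult.assoc)
  have "q u * (\<Sum>v\<in>UNIV. pmf (tremble \<epsilon> S (unit_vec u)) v * B v) = (1 - \<epsilon>) * (q u * B u) + q u * C" for u
  proof (cases "u \<in> S")
    case True
    have "(\<Sum>v\<in>UNIV. unit_vec u v * B v) = (\<Sum>v\<in>UNIV. if v = u then B v else 0)"
      by (rule sum.cong) (auto simp: unit_vec_def)
    then have "(\<Sum>v\<in>UNIV. unit_vec u v * B v) = B u" by simp
    then show ?thesis
      by (simp only: expand[OF unit_vec_in_simplex_on[OF True]]) (simp add: algebra_simps)
  qed (simp add: simplex_onD(2)[OF q])
  then show ?thesis
    using simplex_onD(3)[OF q]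
    by (simp add: expand[OF q] sum.distrib sum_distrib_left[symmetric] sum_distrib_right[symmetric])
qed

section \<open>Trajectories\<close>

lemma expectation_bind_finite:
  fixes h :: "'b \<Rightarrow> real"
  assumes "finite (set_pmf p)" "\<And>x. x \<in> set_pmf p \<Longrightarrow> finite (set_pmf (F x))"
  shows "measure_pmf.expectation (bind_pmf p F) h =
    measure_pmf.expectation p (\<lambda>x. measure_pmf.expectation (F x) h)"
  using assms by (simp add: pmf_expectation_bind[where A = "set_pmf p"] integral_measure_pmf[where A = "set_pmf p"])

lemma expectation_cong_pmf:
  fixes h :: "'b \<Rightarrow> real"
  assumes "\<And>x. x \<in> set_pmf p \<Longrightarrow> h x = h' x"
  shows "measure_pmf.expectation p h = measure_pmf.expectation p h'"
  by (rule integral_cong_AE) (use assms in \<open>auto simp: AE_measure_pmf_iff\<close>)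

lemma expectation_partition:
  fixes h :: "'b \<Rightarrow> real"
  assumes "finite (set_pmf p)"
  shows "measure_pmf.expectation p h =
    (\<Sum>c\<in>\<xi> ` set_pmf p. measure_pmf.expectation p (\<lambda>s. if \<xi> s = c then h s else 0))"
proof -
  have "measure_pmf.expectation p h =
      measure_pmf.expectation p (\<lambda>s. \<Sum>c\<in>\<xi> ` set_pmf p. if \<xi> s = c then h s else 0)"
    using assms by (intro expectation_cong_pmf) simp
  also have "\<dots> = (\<Sum>c\<in>\<xi> ` set_pmf p. measure_pmf.expectation p (\<lambda>s. if \<xi> s = c then h s else 0))"
    by (intro Bochner_Integration.integral_sum integrable_measure_pmf_finite assms)
  finally show ?thesis .
qed

definition extend ::
  "(nat \<Rightarrow> 'x \<Rightarrow> ('i \<Rightarrow> 'u) \<Rightarrow> 'w \<Rightarrow> 'x \<times> ('i \<Rightarrow> 'z) \<times> ('i \<Rightarrow> real))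
   \<Rightarrow> nat \<Rightarrow> ('x,'i,'h,'u,'z) traj \<Rightarrow> ('i \<Rightarrow> 'u) \<Rightarrow> 'w \<Rightarrow> ('x,'i,'h,'u,'z) traj" where
  "extend f t s u w = (case s of (x, h1, recs) \<Rightarrow>
     (case f t x u w of (x', zo, r) \<Rightarrow> (x', h1, recs @ [(u, zo, r)])))"

lemma step_eq: "step f Wd g t s = bind_pmf (Pi_pmf UNIV undefined (\<lambda>i. g i t (hist_of s i)))
    (\<lambda>u. map_pmf (extend f t s u) (Wd t))"
  by (simp add: step_def extend_def map_pmf_def)

text \<open>The current state is dropped because every step overwrites it. Initial information and
  past records are never changed, and they determine \<open>Hv\<close> and
  \<open>Uv\<close>.\<close>

definition prefix_of :: "nat \<Rightarrow> ('x,'i,'h,'u,'z) traj \<Rightarrow> ('i \<Rightarrow> 'h) \<times> ('i,'u,'z) srec list" where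
  "prefix_of n s = (fst (snd s), take n (snd (snd s)))"

lemma prefix_of_extend: "n \<le> length (snd (snd s)) \<Longrightarrow> prefix_of n (extend f t s u w) = prefix_of n s"
  by (auto simp: prefix_of_def extend_def split: prod.splits)

lemma Hv_cong:
  assumes "prefix_of n s = prefix_of n s'" "t - 1 \<le> n"
  shows "Hv i t s = Hv i t s'"
proof -
  have "take (t - 1) (snd (snd s)) = take (t - 1) (snd (snd s'))"
  proof -
    have "take (t - 1) (take n xs) = take (t - 1) xs" for xs :: "'y list"
      using assms(2) by (simp add: min_def)
    moreover have "take n (snd (snd s)) = take n (snd (snd s'))"
      using assms(1) by (simp add: prefix_of_def)
    ultimately show ?thesis by metis
  qed
  then show ?thesis
    using assms(1) by (auto simp: Hv_def hist_of_def prefix_of_def split: prod.splits)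
qed

lemma Uv_cong:
  assumes "prefix_of n s = prefix_of n s'" "t \<in> {1..n}"
  shows "Uv i t s = Uv i t s'"
proof -
  have "snd (snd s) ! (t - 1) = snd (snd s') ! (t - 1)"
  proof -
    have "t - 1 < n" using assms(2) by auto
    moreover have "take n (snd (snd s)) = take n (snd (snd s'))"
      using assms(1) by (simp add: prefix_of_def)
    ultimately show ?thesis by (metis nth_take)
  qed
  then show ?thesis by (auto simp: Uv_def split: prod.splits)
qed

lemma Hv_eq_hist_of: "length (snd (snd s)) = t - 1 \<Longrightarrow> Hv i t s = hist_of s i"
  by (auto simp: Hv_def split: prod.splits)

lemma Hv_extend: "length (snd (snd s)) = t - 1 \<Longrightarrow> Hv i t (extend f t' s u w) = hist_of s i"
  by (auto simp: Hv_def hist_of_def extend_def split: prod.splits)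

lemma Uv_extend: "length (snd (snd s)) = t - 1 \<Longrightarrow> Uv i t (extend f t' s u w) = u i"
  by (auto simp: Uv_def extend_def nth_append split: prod.splits)

context
  fixes f :: "nat \<Rightarrow> 'x::finite \<Rightarrow> ('i::finite \<Rightarrow> 'u::finite) \<Rightarrow> 'w::finite
              \<Rightarrow> 'x \<times> ('i \<Rightarrow> 'z::finite) \<times> ('i \<Rightarrow> real)"
    and mu0 :: "('x \<times> ('i \<Rightarrow> 'h::finite)) pmf"
    and Wd :: "nat \<Rightarrow> 'w pmf"
begin

lemma finite_step: "finite (set_pmf (step f Wd g t s))"
  by (simp add: step_eq)

lemma finite_traj: "finite (set_pmf (traj f mu0 Wd g n))"
  by (induction n) (auto simp: finite_step)

lemma length_traj: "s \<in> set_pmf (traj f mu0 Wd g n) \<Longrightarrow> length (snd (snd s)) = n"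
  by (induction n arbitrary: s) (auto simp: step_eq extend_def split: prod.splits)

lemma expectation_traj_Suc:
  fixes \<phi> :: "_ \<Rightarrow> real"
  shows "measure_pmf.expectation (traj f mu0 Wd g (Suc n)) \<phi> =
    measure_pmf.expectation (traj f mu0 Wd g n) (\<lambda>s. measure_pmf.expectation (step f Wd g (Suc n) s) \<phi>)"
  by (simp add: expectation_bind_finite finite_traj finite_step)

lemma expectation_step:
  fixes \<phi> :: "_ \<Rightarrow> real"
  shows "measure_pmf.expectation (step f Wd g t s) \<phi> = (\<Sum>u\<in>UNIV. (\<Prod>i\<in>UNIV. pmf (g i t (hist_of s i)) (u i)) *
    measure_pmf.expectation (Wd t) (\<lambda>w. \<phi> (extend f t s u w)))"
  by (simp add: step_eq expectation_bind_finite integral_measure_pmf[where A = UNIV] pmf_Pi)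

text \<open>The integrand must vary with \<open>m\<close> for the induction: peeling off the last
  step turns its expectation, which depends on \<open>G m\<close>, into the integrand of the shorter
  trajectory.\<close>

lemma expectation_traj_tendsto:
  assumes "\<And>i t h u. t \<in> {1..n} \<Longrightarrow> (\<lambda>m::nat. pmf (G m i t h) u) \<longlonglongrightarrow> pmf (g i t h) u"
    and "\<And>s. (\<lambda>m. \<phi> m s :: real) \<longlonglongrightarrow> \<psi> s"
  shows "(\<lambda>m. measure_pmf.expectation (traj f mu0 Wd (G m) n) (\<phi> m))
    \<longlonglongrightarrow> measure_pmf.expectation (traj f mu0 Wd g n) \<psi>"
  using assms
proof (induction n arbitrary: \<phi> \<psi>)
  case 0
  then show ?case
    by (auto simp: integral_measure_pmf[where A = UNIV] intro!: tendsto_intros)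
next
  case (Suc n)
  show ?case
    unfolding expectation_traj_Suc
  proof (rule Suc.IH)
    show "(\<lambda>m. measure_pmf.expectation (step f Wd (G m) (Suc n) s) (\<phi> m))
        \<longlonglongrightarrow> measure_pmf.expectation (step f Wd g (Suc n) s) \<psi>" for s
      unfolding expectation_step
      by (intro tendsto_sum tendsto_mult tendsto_prod Suc.prems(1))
         (auto simp: integral_measure_pmf[where A = UNIV] intro!: tendsto_intros Suc.prems(2))
  qed (use Suc.prems(1) in auto)
qed

lemma payoff_tendsto:
  assumes "\<And>i t h u. t \<in> {1..T} \<Longrightarrow> (\<lambda>m::nat. pmf (G m i t h) u) \<longlonglongrightarrow> pmf (g i t h) u"
  shows "(\<lambda>m. payoff f mu0 Wd T (G m) i) \<longlonglongrightarrow> payoff f mu0 Wd T g i"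
  unfolding payoff_def by (rule expectation_traj_tendsto) (use assms in auto)

lemma traj_cong:
  assumes "\<And>i t. t \<in> {1..n} \<Longrightarrow> g i t = g' i t"
  shows "traj f mu0 Wd g n = traj f mu0 Wd g' n"
  using assms
proof (induction n)
  case (Suc n)
  have "g i (Suc n) = g' i (Suc n)" for i using Suc.prems by simp
  then have "step f Wd g (Suc n) = step f Wd g' (Suc n)"
    by (intro ext) (simp add: step_def)
  moreover have "traj f mu0 Wd g n = traj f mu0 Wd g' n"
    using Suc by auto
  ultimately show ?case by simp
qed simp

text \<open>Applied with a \<open>g'\<close> under which all actions available to the deviator have
  positive probability: what a deviation can reach is then reached without it.\<close>

lemma set_traj_mono:
  assumes "\<And>i t h. t \<in> {1..n} \<Longrightarrow> set_pmf (g i t h) \<subseteq> set_pmf (g' i t h)"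
  shows "set_pmf (traj f mu0 Wd g n) \<subseteq> set_pmf (traj f mu0 Wd g' n)"
  using assms
proof (induction n)
  case (Suc n)
  have "set_pmf (step f Wd g (Suc n) s) \<subseteq> set_pmf (step f Wd g' (Suc n) s)" for s
    unfolding step_eq set_bind_pmf using Suc.prems
    by (intro UN_mono) (auto simp: set_Pi_pmf PiE_dflt_def subset_iff)
  moreover have "set_pmf (traj f mu0 Wd g n) \<subseteq> set_pmf (traj f mu0 Wd g' n)"
    using Suc by auto
  ultimately show ?case by fastforce
qed simp

text \<open>Later steps only append records, so the law of the first \<open>n\<close> records is
  settled at time \<open>n\<close>. Expectations over all \<open>T\<close> steps that involve
  \<open>Hv i t\<close> can thus be computed after \<open>t - 1\<close> steps, before the action at
  time \<open>t\<close>.\<close>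

lemma map_prefix_of_traj:
  assumes "n \<le> m"
  shows "map_pmf (prefix_of n) (traj f mu0 Wd g m) = map_pmf (prefix_of n) (traj f mu0 Wd g n)"
  using assms
proof (induction m rule: dec_induct)
  case (step m)
  have "map_pmf (prefix_of n) (traj f mu0 Wd g (Suc m)) =
      bind_pmf (traj f mu0 Wd g m) (\<lambda>s. map_pmf (prefix_of n) (step f Wd g (Suc m) s))"
    by (simp add: map_bind_pmf)
  also have "\<dots> = bind_pmf (traj f mu0 Wd g m) (\<lambda>s. return_pmf (prefix_of n s))"
  proof (rule bind_pmf_cong[OF refl])
    fix s assume "s \<in> set_pmf (traj f mu0 Wd g m)"
    then have "n \<le> length (snd (snd s))" using length_traj step by auto
    then show "map_pmf (prefix_of n) (step f Wd g (Suc m) s) = return_pmf (prefix_of n s)"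
      by (simp add: step_eq map_bind_pmf pmf.map_comp o_def prefix_of_extend map_pmf_const)
  qed
  also have "\<dots> = map_pmf (prefix_of n) (traj f mu0 Wd g m)"
    by (simp add: map_pmf_def)
  finally show ?case using step.IH by simp
qed simp

lemma expectation_traj_prefix:
  fixes \<phi> :: "_ \<Rightarrow> real"
  assumes "n \<le> m" "\<And>s s'. prefix_of n s = prefix_of n s' \<Longrightarrow> \<phi> s = \<phi> s'"
  shows "measure_pmf.expectation (traj f mu0 Wd g m) \<phi> = measure_pmf.expectation (traj f mu0 Wd g n) \<phi>"
proof -
  define \<psi> where "\<psi> p = \<phi> (SOME s. prefix_of n s = p)" for p
  have "\<phi> s = \<psi> (prefix_of n s)" for s
    unfolding \<psi>_def
    by (rule assms(2)) (rule someI[of "\<lambda>s'. prefix_of n s' = prefix_of n s" s, OF refl, symmetric])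
  then have "\<phi> = (\<lambda>s. \<psi> (prefix_of n s))" by (rule ext)
  then have "measure_pmf.expectation (traj f mu0 Wd g k) \<phi> =
      measure_pmf.expectation (map_pmf (prefix_of n) (traj f mu0 Wd g k)) \<psi>" for k
    by simp
  then show ?thesis by (simp only: map_prefix_of_traj[OF assms(1)])
qed

lemma expectation_Hv_prefix:
  fixes F :: "_ \<Rightarrow> real"
  assumes "t - 1 \<le> n"
  shows "measure_pmf.expectation (traj f mu0 Wd g n) (\<lambda>s. F (Hv i t s)) =
    measure_pmf.expectation (traj f mu0 Wd g (t - 1)) (\<lambda>s. F (Hv i t s))"
  by (rule expectation_traj_prefix[OF assms]) (rule arg_cong[of _ _ F], erule Hv_cong, rule order_refl)

text \<open>Given the past, player \<open>i\<close> draws from \<open>g i t\<close> at the own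
  history, independently of the others, so their draws integrate out.\<close>

lemma expectation_action:
  fixes F :: "_ \<Rightarrow> _ \<Rightarrow> real"
  assumes t: "t \<in> {1..n}"
  shows "measure_pmf.expectation (traj f mu0 Wd g n) (\<lambda>s. F (Hv i t s) (Uv i t s)) =
    measure_pmf.expectation (traj f mu0 Wd g n)
      (\<lambda>s. \<Sum>u\<in>UNIV. pmf (g i t (Hv i t s)) u * F (Hv i t s) u)"
proof -
  obtain m where m: "t = Suc m" using t by (cases t) auto
  have "measure_pmf.expectation (traj f mu0 Wd g n) (\<lambda>s. F (Hv i t s) (Uv i t s)) =
      measure_pmf.expectation (traj f mu0 Wd g t) (\<lambda>s. F (Hv i t s) (Uv i t s))"
  proof (rule expectation_traj_prefix)
    show "t \<le> n" using t by simp
    fix s s' :: "('x,'i,'h,'u,'z) traj" assume eq: "prefix_of t s = prefix_of t s'"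
    have "t - 1 \<le> t" "t \<in> {1..t}" using t by auto
    then show "F (Hv i t s) (Uv i t s) = F (Hv i t s') (Uv i t s')"
      by (simp only: Hv_cong[OF eq] Uv_cong[OF eq])
  qed
  also have "\<dots> = measure_pmf.expectation (traj f mu0 Wd g m)
      (\<lambda>s. measure_pmf.expectation (step f Wd g t s) (\<lambda>s. F (Hv i t s) (Uv i t s)))"
    by (simp only: m expectation_traj_Suc)
  also have "\<dots> = measure_pmf.expectation (traj f mu0 Wd g m)
      (\<lambda>s. \<Sum>u\<in>UNIV. pmf (g i t (Hv i t s)) u * F (Hv i t s) u)"
  proof (rule expectation_cong_pmf)
    fix s assume "s \<in> set_pmf (traj f mu0 Wd g m)"
    then have len: "length (snd (snd s)) = t - 1" using length_traj m by auto
    have "measure_pmf.expectation (step f Wd g t s) (\<lambda>s. F (Hv i t s) (Uv i t s)) =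
        measure_pmf.expectation (Pi_pmf UNIV undefined (\<lambda>i. g i t (hist_of s i))) (\<lambda>u. F (hist_of s i) (u i))"
      by (simp add: step_eq expectation_bind_finite Hv_extend[OF len] Uv_extend[OF len])
    also have "\<dots> = measure_pmf.expectation
        (map_pmf (\<lambda>u. u i) (Pi_pmf UNIV undefined (\<lambda>i. g i t (hist_of s i)))) (F (hist_of s i))"
      by simp
    also have "\<dots> = (\<Sum>u\<in>UNIV. pmf (g i t (hist_of s i)) u * F (hist_of s i) u)"
      by (subst Pi_pmf_component) (simp_all add: integral_measure_pmf[where A = UNIV])
    finally show "measure_pmf.expectation (step f Wd g t s) (\<lambda>s. F (Hv i t s) (Uv i t s)) =
        (\<Sum>u\<in>UNIV. pmf (g i t (Hv i t s)) u * F (Hv i t s) u)"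
      by (simp add: Hv_eq_hist_of[OF len])
  qed
  also have "\<dots> = measure_pmf.expectation (traj f mu0 Wd g n)
      (\<lambda>s. \<Sum>u\<in>UNIV. pmf (g i t (Hv i t s)) u * F (Hv i t s) u)"
    using expectation_Hv_prefix[of t n g "\<lambda>h. \<Sum>u\<in>UNIV. pmf (g i t h) u * F h u" i] t m by simp
  finally show ?thesis .
qed

end

section \<open>Information states\<close>

context
  fixes f :: "nat \<Rightarrow> 'x::finite \<Rightarrow> ('i::finite \<Rightarrow> 'u::finite) \<Rightarrow> 'w::finite
              \<Rightarrow> 'x \<times> ('i \<Rightarrow> 'z::finite) \<times> ('i \<Rightarrow> real)"
    and mu0 :: "('x \<times> ('i \<Rightarrow> 'h::finite)) pmf"
    and Wd :: "nat \<Rightarrow> 'w pmf"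
    and T :: nat
    and Uset :: "nat \<Rightarrow> 'i \<Rightarrow> 'u set"
    and iota1 :: "'i \<Rightarrow> 'h \<Rightarrow> 'k::finite"
    and iota :: "nat \<Rightarrow> 'i \<Rightarrow> 'k \<Rightarrow> ('u \<times> 'z) \<Rightarrow> 'k"
begin

lemma integrable_traj: "integrable (measure_pmf (traj f mu0 Wd g n)) (\<phi> :: _ \<Rightarrow> real)"
  by (rule integrable_measure_pmf_finite[OF finite_traj])

text \<open>The elementary ratios at single pairs of history and action are summed up to an identity
  for expectations, with a test function \<open>V\<close> of the next compressed state.
  \<open>P\<close> and \<open>r\<close> are fixed before \<open>gi\<close>, hence shared by all
  deviations. At \<open>t = T\<close> there is no kernel for a next state, so \<open>V\<close> must
  vanish there.\<close>

lemma info_state_expectation: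
  assumes "info_state f mu0 Wd T Uset iota1 iota i g"
  obtains P :: "nat \<Rightarrow> 'k \<Rightarrow> 'u \<Rightarrow> 'k pmf" and r :: "nat \<Rightarrow> 'k \<Rightarrow> 'u \<Rightarrow> real"
  where "\<And>gi t V. is_bstrat Uset T i gi \<Longrightarrow> t \<in> {1..T} \<Longrightarrow> (t = T \<Longrightarrow> V = (\<lambda>_. 0)) \<Longrightarrow>
    measure_pmf.expectation (traj f mu0 Wd (g(i := gi)) T)
      (\<lambda>s. Rv i t s + V (kcomp iota1 iota i (Hv i (Suc t) s))) =
    measure_pmf.expectation (traj f mu0 Wd (g(i := gi)) T)
      (\<lambda>s. r t (kcomp iota1 iota i (Hv i t s)) (Uv i t s) +
        (\<Sum>k'\<in>UNIV. V k' * pmf (P t (kcomp iota1 iota i (Hv i t s)) (Uv i t s)) k'))"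
proof -
  define \<kappa> where "\<kappa> = kcomp iota1 iota i"
  obtain P :: "nat \<Rightarrow> 'k \<Rightarrow> 'u \<Rightarrow> 'k pmf" and r :: "nat \<Rightarrow> 'k \<Rightarrow> 'u \<Rightarrow> real" where
    Pr: "\<And>gi t h u. is_bstrat Uset T i gi \<Longrightarrow> t \<in> {1..T} \<Longrightarrow>
      measure_pmf.prob (traj f mu0 Wd (g(i := gi)) T) {s. Hv i t s = h \<and> Uv i t s = u} > 0 \<Longrightarrow>
      (t < T \<longrightarrow> (\<forall>k'.
         measure_pmf.prob (traj f mu0 Wd (g(i := gi)) T)
           {s. Hv i t s = h \<and> Uv i t s = u \<and> \<kappa> (Hv i (t + 1) s) = k'} /
         measure_pmf.prob (traj f mu0 Wd (g(i := gi)) T) {s. Hv i t s = h \<and> Uv i t s = u}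
         = pmf (P t (\<kappa> h) u) k')) \<and>
      measure_pmf.expectation (traj f mu0 Wd (g(i := gi)) T)
         (\<lambda>s. if Hv i t s = h \<and> Uv i t s = u then Rv i t s else 0) /
         measure_pmf.prob (traj f mu0 Wd (g(i := gi)) T) {s. Hv i t s = h \<and> Uv i t s = u}
         = r t (\<kappa> h) u"
    using assms unfolding info_state_def Let_def \<kappa>_def by blast
  show ?thesis
  proof (rule that[of r P], fold \<kappa>_def)
    fix gi :: "('h,'u,'z) bstrat" and t and V :: "'k \<Rightarrow> real"
    assume gi: "is_bstrat Uset T i gi" and t: "t \<in> {1..T}" and V: "t = T \<Longrightarrow> V = (\<lambda>_. 0)"
    define D where "D = traj f mu0 Wd (g(i := gi)) T"
    define \<xi> where "\<xi> s = (Hv i t s, Uv i t s)" for s :: "('x,'i,'h,'u,'z) traj"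
    define Q where "Q k u = r t k u + (\<Sum>k'\<in>UNIV. V k' * pmf (P t k u) k')" for k u
    have fin: "finite (set_pmf D)" by (simp add: D_def finite_traj)
    have int: "integrable (measure_pmf D) (\<phi> :: _ \<Rightarrow> real)" for \<phi>
      by (simp add: D_def integrable_traj)
    \<comment> \<open>Only pairs \<open>c\<close> attained on the support occur in the partition, so
      the conditioning event has positive probability and the ratios can be multiplied out.\<close>
    have "measure_pmf.expectation D (\<lambda>s. if \<xi> s = c then Rv i t s + V (\<kappa> (Hv i (Suc t) s)) else 0) =
        measure_pmf.expectation D (\<lambda>s. if \<xi> s = c then Q (\<kappa> (Hv i t s)) (Uv i t s) else 0)"
      if "c \<in> \<xi> ` set_pmf D" for c
    proof -
      obtain h u where c: "c = (h, u)" by (cases c)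
      define A where "A = {s :: ('x,'i,'h,'u,'z) traj. Hv i t s = h \<and> Uv i t s = u}"
      define p where "p = measure_pmf.prob D A"
      have "p > 0" using that unfolding p_def A_def c \<xi>_def by (auto intro!: measure_pmf_posI)
      from Pr[OF gi t, of h u, folded D_def, folded A_def, folded p_def, OF this]
      have PV: "t < T \<Longrightarrow> measure_pmf.prob D {s. Hv i t s = h \<and> Uv i t s = u \<and> \<kappa> (Hv i (t + 1) s) = k'}
            = p * pmf (P t (\<kappa> h) u) k'"
        and R: "measure_pmf.expectation D (\<lambda>s. if Hv i t s = h \<and> Uv i t s = u then Rv i t s else 0)
            = p * r t (\<kappa> h) u" for k'
        using \<open>p > 0\<close> by (auto simp: field_simps)
      have "measure_pmf.expectation D (\<lambda>s. if \<xi> s = c then V (\<kappa> (Hv i (Suc t) s)) else 0) =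
          p * (\<Sum>k'\<in>UNIV. V k' * pmf (P t (\<kappa> h) u) k')"
      proof (cases "t < T")
        case True
        define I where "I k' = {s :: ('x,'i,'h,'u,'z) traj. Hv i t s = h \<and> Uv i t s = u \<and> \<kappa> (Hv i (t + 1) s) = k'}" for k'
        have "(if \<xi> s = c then V (\<kappa> (Hv i (Suc t) s)) else 0) = (\<Sum>k'\<in>UNIV. V k' * indicator (I k') s)" for s
        proof -
          have "(\<Sum>k'\<in>UNIV. V k' * indicator (I k') s) =
              (\<Sum>k'\<in>UNIV. if k' = \<kappa> (Hv i (Suc t) s) then (if \<xi> s = c then V k' else 0) else 0)"
            by (rule sum.cong) (auto simp: I_def \<xi>_def c indicator_def)
          then show ?thesis by simp
        qed
        then have "measure_pmf.expectation D (\<lambda>s. if \<xi> s = c then V (\<kappa> (Hv i (Suc t) s)) else 0) =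
            measure_pmf.expectation D (\<lambda>s. \<Sum>k'\<in>UNIV. V k' * indicator (I k') s)"
          by presburger
        also have "\<dots> = (\<Sum>k'\<in>UNIV. measure_pmf.expectation D (\<lambda>s. V k' * indicator (I k') s))"
          by (rule Bochner_Integration.integral_sum) (rule int)
        also have "\<dots> = (\<Sum>k'\<in>UNIV. V k' * measure_pmf.prob D (I k'))"
          by simp
        finally have "measure_pmf.expectation D (\<lambda>s. if \<xi> s = c then V (\<kappa> (Hv i (Suc t) s)) else 0) =
            (\<Sum>k'\<in>UNIV. V k' * measure_pmf.prob D
              {s. Hv i t s = h \<and> Uv i t s = u \<and> \<kappa> (Hv i (t + 1) s) = k'})"
          by (simp only: I_def)
        then show ?thesis
          unfolding PV[OF True] by (simp add: sum_distrib_left mult.left_commute)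
      next
        case False
        then have "t = T" using t by simp
        show ?thesis unfolding V[OF \<open>t = T\<close>] by simp
      qed
      moreover have "measure_pmf.expectation D (\<lambda>s. if \<xi> s = c then Rv i t s else 0) = p * r t (\<kappa> h) u"
        using R by (simp add: \<xi>_def c)
      moreover have "measure_pmf.expectation D
            (\<lambda>s. if \<xi> s = c then Rv i t s + V (\<kappa> (Hv i (Suc t) s)) else 0) =
          measure_pmf.expectation D (\<lambda>s. if \<xi> s = c then Rv i t s else 0) +
          measure_pmf.expectation D (\<lambda>s. if \<xi> s = c then V (\<kappa> (Hv i (Suc t) s)) else 0)"
        by (subst Bochner_Integration.integral_add[symmetric, OF int int])
           (auto intro!: Bochner_Integration.integral_cong)
      moreover have "measure_pmf.expectation D
            (\<lambda>s. if \<xi> s = c then Q (\<kappa> (Hv i t s)) (Uv i t s) else 0) =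
          measure_pmf.expectation D (\<lambda>s. indicator A s * Q (\<kappa> h) u)"
        by (rule Bochner_Integration.integral_cong) (auto simp: \<xi>_def c A_def)
      moreover have "measure_pmf.expectation D (\<lambda>s. indicator A s * Q (\<kappa> h) u) = p * Q (\<kappa> h) u"
        by (simp add: p_def)
      ultimately show ?thesis
        by (simp only: Q_def distrib_left)
    qed
    then have "measure_pmf.expectation D (\<lambda>s. Rv i t s + V (\<kappa> (Hv i (Suc t) s))) =
        measure_pmf.expectation D (\<lambda>s. Q (\<kappa> (Hv i t s)) (Uv i t s))"
      by (subst (1 2) expectation_partition[OF fin, of _ \<xi>]) (rule sum.cong[OF refl])
    then show "measure_pmf.expectation (traj f mu0 Wd (g(i := gi)) T)
        (\<lambda>s. Rv i t s + V (\<kappa> (Hv i (Suc t) s))) =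
      measure_pmf.expectation (traj f mu0 Wd (g(i := gi)) T)
        (\<lambda>s. r t (\<kappa> (Hv i t s)) (Uv i t s) +
          (\<Sum>k'\<in>UNIV. V k' * pmf (P t (\<kappa> (Hv i t s)) (Uv i t s)) k'))"
      by (simp add: D_def Q_def)
  qed
qed

lemma policy_value_exists:
  fixes P :: "nat \<Rightarrow> 'k \<Rightarrow> 'u \<Rightarrow> 'k pmf" and r :: "nat \<Rightarrow> 'k \<Rightarrow> 'u \<Rightarrow> real"
    and p :: "('k, 'u) kstrat"
  obtains V :: "nat \<Rightarrow> 'k \<Rightarrow> real" where "V (Suc T) = (\<lambda>_. 0)"
    "\<And>t k. t \<in> {1..T} \<Longrightarrow> V t k =
      (\<Sum>u\<in>UNIV. pmf (p t k) u * (r t k u + (\<Sum>k'\<in>UNIV. V (Suc t) k' * pmf (P t k u) k')))"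
proof -
  \<comment> \<open>The recursion counts remaining periods: \<open>W (Suc m)\<close> is the value at
    time \<open>T - m\<close>.\<close>
  define W where "W = rec_nat (\<lambda>_. 0) (\<lambda>m W k. \<Sum>u\<in>UNIV. pmf (p (T - m) k) u *
    (r (T - m) k u + (\<Sum>k'\<in>UNIV. W k' * pmf (P (T - m) k u) k')))"
  define V where "V t = W (Suc T - t)" for t
  have "V t k = (\<Sum>u\<in>UNIV. pmf (p t k) u * (r t k u + (\<Sum>k'\<in>UNIV. V (Suc t) k' * pmf (P t k u) k')))"
    if "t \<in> {1..T}" for t k
  proof -
    have "Suc T - t = Suc (T - t)" "T - (T - t) = t" using that by auto
    then show ?thesis by (simp add: V_def W_def)
  qed
  moreover have "V (Suc T) = (\<lambda>_. 0)" by (simp add: V_def W_def)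
  ultimately show ?thesis using that by blast
qed

text \<open>\<open>A\<close> is the advantage function of the policy \<open>p\<close> in the Markov decision process on
  compressed states, and the identity is the performance difference formula. It holds for
  full-history strategies because their rewards and compressed states follow the same kernels.\<close>

lemma performance_difference:
  fixes p :: "('k, 'u) kstrat"
  assumes "info_state f mu0 Wd T Uset iota1 iota i g"
  obtains A :: "nat \<Rightarrow> 'k \<Rightarrow> 'u \<Rightarrow> real" and c :: real
  where "\<And>t k. t \<in> {1..T} \<Longrightarrow> (\<Sum>u\<in>UNIV. pmf (p t k) u * A t k u) = 0"
    and "\<And>gi. is_bstrat Uset T i gi \<Longrightarrow> payoff f mu0 Wd T (g(i := gi)) i = c +
      (\<Sum>t\<in>{1..T}. measure_pmf.expectation (traj f mu0 Wd (g(i := gi)) T)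
        (\<lambda>s. \<Sum>u\<in>UNIV. pmf (gi t (Hv i t s)) u * A t (kcomp iota1 iota i (Hv i t s)) u))"
proof -
  define \<kappa> where "\<kappa> = kcomp iota1 iota i"
  obtain P :: "nat \<Rightarrow> 'k \<Rightarrow> 'u \<Rightarrow> 'k pmf" and r :: "nat \<Rightarrow> 'k \<Rightarrow> 'u \<Rightarrow> real" where
    Pr: "\<And>gi t V. is_bstrat Uset T i gi \<Longrightarrow> t \<in> {1..T} \<Longrightarrow> (t = T \<Longrightarrow> V = (\<lambda>_. 0)) \<Longrightarrow>
      measure_pmf.expectation (traj f mu0 Wd (g(i := gi)) T)
        (\<lambda>s. Rv i t s + V (\<kappa> (Hv i (Suc t) s))) =
      measure_pmf.expectation (traj f mu0 Wd (g(i := gi)) T)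
        (\<lambda>s. r t (\<kappa> (Hv i t s)) (Uv i t s) +
          (\<Sum>k'\<in>UNIV. V k' * pmf (P t (\<kappa> (Hv i t s)) (Uv i t s)) k'))"
    by (rule info_state_expectation[OF assms, folded \<kappa>_def]) blast
  obtain V :: "nat \<Rightarrow> 'k \<Rightarrow> real" where VT: "V (Suc T) = (\<lambda>_. 0)" and
    V: "\<And>t k. t \<in> {1..T} \<Longrightarrow> V t k =
      (\<Sum>u\<in>UNIV. pmf (p t k) u * (r t k u + (\<Sum>k'\<in>UNIV. V (Suc t) k' * pmf (P t k u) k')))"
    by (rule policy_value_exists[of p r P]) blast
  define Q where "Q t k u = r t k u + (\<Sum>k'\<in>UNIV. V (Suc t) k' * pmf (P t k u) k')" for t k u
  define A where "A t k u = Q t k u - V t k" for t k u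
  \<comment> \<open>No action has been taken after 0 steps, so this expected initial value is the
    same for every deviation \<open>gi\<close>.\<close>
  define c where "c = measure_pmf.expectation (traj f mu0 Wd g 0) (\<lambda>s. V 1 (\<kappa> (Hv i 1 s)))"
  show ?thesis
  proof (rule that[of A c], fold \<kappa>_def)
    fix t k assume "t \<in> {1..T}"
    then have "V t k = (\<Sum>u\<in>UNIV. pmf (p t k) u * Q t k u)" by (simp add: V Q_def)
    moreover have "(\<Sum>u\<in>UNIV. pmf (p t k) u) = 1" by (rule sum_pmf_eq_1) auto
    ultimately show "(\<Sum>u\<in>UNIV. pmf (p t k) u * A t k u) = 0"
      by (simp add: A_def right_diff_distrib sum_subtractf flip: sum_distrib_right)
  next
    fix gi :: "('h,'u,'z) bstrat" assume gi: "is_bstrat Uset T i gi"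
    define D where "D = traj f mu0 Wd (g(i := gi)) T"
    have int: "integrable (measure_pmf D) (\<phi> :: _ \<Rightarrow> real)" for \<phi>
      by (simp add: D_def integrable_traj)
    define e where "e t = measure_pmf.expectation D (\<lambda>s. V t (\<kappa> (Hv i t s)))" for t
    \<comment> \<open>With \<open>V (Suc t)\<close> as test function, the expected reward becomes
      the drop in expected value plus the expected advantage. The drops telescope over
      \<open>t\<close>, leaving \<open>c\<close>.\<close>
    have reward: "measure_pmf.expectation D (\<lambda>s. Rv i t s) = e t - e (Suc t) +
        measure_pmf.expectation D (\<lambda>s. \<Sum>u\<in>UNIV. pmf (gi t (Hv i t s)) u * A t (\<kappa> (Hv i t s)) u)"
      if t: "t \<in> {1..T}" for t
    proof -
      have "measure_pmf.expectation D (\<lambda>s. Rv i t s) + e (Suc t) =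
          measure_pmf.expectation D (\<lambda>s. Rv i t s + V (Suc t) (\<kappa> (Hv i (Suc t) s)))"
        by (simp add: e_def int)
      also have "\<dots> = measure_pmf.expectation D (\<lambda>s. Q t (\<kappa> (Hv i t s)) (Uv i t s))"
        unfolding D_def Q_def by (rule Pr[OF gi t]) (simp add: VT)
      also have "\<dots> = e t + measure_pmf.expectation D (\<lambda>s. A t (\<kappa> (Hv i t s)) (Uv i t s))"
        by (simp add: e_def A_def int)
      also have "measure_pmf.expectation D (\<lambda>s. A t (\<kappa> (Hv i t s)) (Uv i t s)) =
          measure_pmf.expectation D (\<lambda>s. \<Sum>u\<in>UNIV. pmf (gi t (Hv i t s)) u * A t (\<kappa> (Hv i t s)) u)"
        using expectation_action[OF t, of f mu0 Wd "g(i := gi)" "\<lambda>h. A t (\<kappa> h)" i] by (simp add: D_def)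
      finally show ?thesis by simp
    qed
    have "e 1 = measure_pmf.expectation (traj f mu0 Wd (g(i := gi)) 0) (\<lambda>s. V 1 (\<kappa> (Hv i 1 s)))"
      unfolding e_def D_def
      using expectation_Hv_prefix[of 1 T f mu0 Wd "g(i := gi)" "\<lambda>h. V 1 (\<kappa> h)" i] by simp
    then have "e 1 = c" by (simp add: c_def)
    have "e (Suc T) = 0" by (simp add: e_def VT)
    have "(\<Sum>t\<in>{1..T}. e t - e (Suc t)) = e 1 - e (Suc T)"
      by (induction T) auto
    then have tele: "(\<Sum>t\<in>{1..T}. e t - e (Suc t)) = c"
      using \<open>e 1 = c\<close> \<open>e (Suc T) = 0\<close> by simp
    have "payoff f mu0 Wd T (g(i := gi)) i = (\<Sum>t\<in>{1..T}. measure_pmf.expectation D (\<lambda>s. Rv i t s))"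
      unfolding payoff_def D_def[symmetric] by (rule Bochner_Integration.integral_sum) (rule int)
    also have "\<dots> = (\<Sum>t\<in>{1..T}. e t - e (Suc t)) + (\<Sum>t\<in>{1..T}. measure_pmf.expectation D
        (\<lambda>s. \<Sum>u\<in>UNIV. pmf (gi t (Hv i t s)) u * A t (\<kappa> (Hv i t s)) u))"
      by (simp only: sum.distrib[symmetric] reward cong: sum.cong)
    finally show "payoff f mu0 Wd T (g(i := gi)) i = c +
      (\<Sum>t\<in>{1..T}. measure_pmf.expectation (traj f mu0 Wd (g(i := gi)) T)
        (\<lambda>s. \<Sum>u\<in>UNIV. pmf (gi t (Hv i t s)) u * A t (\<kappa> (Hv i t s)) u))"
      by (simp only: tele D_def)
  qed
qed

section \<open>Deviations of a single agent\<close>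

definition deviate :: "'i \<Rightarrow> ('h,'u,'z) bstrat \<Rightarrow> nat \<Rightarrow> 'k \<Rightarrow> 'u pmf \<Rightarrow> ('h,'u,'z) bstrat" where
  "deviate i gi t k \<alpha> = (\<lambda>t' h. if t' = t \<and> kcomp iota1 iota i h = k then \<alpha> else gi t' h)"

lemma is_bstrat_induced:
  "is_kstrat Uset T i (rho i) \<Longrightarrow> is_bstrat Uset T i (induced iota1 iota rho i)"
  by (simp add: is_kstrat_def is_bstrat_def induced_def)

text \<open>The last clause is one-shot deviation: the advantage is only controlled at compressed
  states that are reached, so it needs every action available to the deviator to have
  positive probability under \<open>rho\<close>.\<close>

lemma one_shot_deviation:
  assumes "info_state f mu0 Wd T Uset iota1 iota i (induced iota1 iota rho)"
    and rho: "is_kstrat Uset T i (rho i)"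
  obtains A :: "nat \<Rightarrow> 'k \<Rightarrow> 'u \<Rightarrow> real" and w :: "nat \<Rightarrow> 'k \<Rightarrow> real"
  where "\<And>t k. t \<in> {1..T} \<Longrightarrow> (\<Sum>u\<in>UNIV. pmf (rho i t k) u * A t k u) = 0"
    and "\<And>t k \<alpha>. t \<in> {1..T} \<Longrightarrow> set_pmf \<alpha> \<subseteq> Uset t i \<Longrightarrow>
      payoff f mu0 Wd T ((induced iota1 iota rho)(i := deviate i (induced iota1 iota rho i) t k \<alpha>)) i =
      payoff f mu0 Wd T (induced iota1 iota rho) i + w t k * (\<Sum>u\<in>UNIV. pmf \<alpha> u * A t k u)"
    and "\<And>gi. is_bstrat Uset T i gi \<Longrightarrow>
      (\<And>t k. t \<in> {1..T} \<Longrightarrow> Uset t i \<subseteq> set_pmf (rho i t k)) \<Longrightarrow>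
      (\<And>t h. t \<in> {1..T} \<Longrightarrow> w t (kcomp iota1 iota i h) > 0 \<Longrightarrow>
        (\<Sum>u\<in>UNIV. pmf (gi t h) u * A t (kcomp iota1 iota i h) u) \<le> 0) \<Longrightarrow>
      payoff f mu0 Wd T ((induced iota1 iota rho)(i := gi)) i \<le> payoff f mu0 Wd T (induced iota1 iota rho) i"
proof -
  define g where "g = induced iota1 iota rho"
  define \<kappa> where "\<kappa> = kcomp iota1 iota i"
  have g_i: "g i t h = rho i t (\<kappa> h)" for t h by (simp add: g_def induced_def \<kappa>_def)
  obtain A :: "nat \<Rightarrow> 'k \<Rightarrow> 'u \<Rightarrow> real" and c :: real where
    A0: "\<And>t k. t \<in> {1..T} \<Longrightarrow> (\<Sum>u\<in>UNIV. pmf (rho i t k) u * A t k u) = 0" and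
    A: "\<And>gi. is_bstrat Uset T i gi \<Longrightarrow> payoff f mu0 Wd T (g(i := gi)) i = c +
      (\<Sum>t\<in>{1..T}. measure_pmf.expectation (traj f mu0 Wd (g(i := gi)) T)
        (\<lambda>s. \<Sum>u\<in>UNIV. pmf (gi t (Hv i t s)) u * A t (\<kappa> (Hv i t s)) u))"
    by (rule performance_difference[OF assms(1), of "rho i", folded \<kappa>_def g_def]) blast
  have g_bstrat: "is_bstrat Uset T i (g i)"
    unfolding g_def by (rule is_bstrat_induced[of i rho, OF rho])
  have base: "payoff f mu0 Wd T g i = c"
    using A[OF g_bstrat] A0 by (simp add: g_i)
  \<comment> \<open>The probability under \<open>rho\<close> that the compressed state at time
    \<open>t\<close> is \<open>k\<close>. It is measured after \<open>t - 1\<close> steps, on which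
    a deviation at time \<open>t\<close> has no influence.\<close>
  define w where "w t k = measure_pmf.prob (traj f mu0 Wd g (t - 1)) {s. \<kappa> (Hv i t s) = k}" for t k
  show ?thesis
  proof (rule that[of A w], fold g_def \<kappa>_def)
    show "(\<Sum>u\<in>UNIV. pmf (rho i t k) u * A t k u) = 0" if "t \<in> {1..T}" for t k
      by (rule A0[OF that])
  next
    fix t k and \<alpha> :: "'u pmf"
    assume t: "t \<in> {1..T}" and \<alpha>: "set_pmf \<alpha> \<subseteq> Uset t i"
    define gi where "gi = deviate i (g i) t k \<alpha>"
    define B where "B = (\<Sum>u\<in>UNIV. pmf \<alpha> u * A t k u)"
    have gi: "is_bstrat Uset T i gi"
      using g_bstrat \<alpha> by (auto simp: gi_def deviate_def is_bstrat_def)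
    \<comment> \<open>Everywhere else the deviation follows \<open>rho\<close>, whose own advantage
      averages to zero, so a single term of the performance difference survives.\<close>
    have val: "(\<Sum>u\<in>UNIV. pmf (gi t' h) u * A t' (\<kappa> h) u) = (if t' = t \<and> \<kappa> h = k then B else 0)"
      if "t' \<in> {1..T}" for t' h
      using A0[OF that] by (simp add: gi_def deviate_def B_def g_i \<kappa>_def[symmetric])
    have "payoff f mu0 Wd T (g(i := gi)) i = c + (\<Sum>t'\<in>{1..T}.
        measure_pmf.expectation (traj f mu0 Wd (g(i := gi)) T)
          (\<lambda>s. if t' = t \<and> \<kappa> (Hv i t' s) = k then B else 0))"
      unfolding A[OF gi] by (simp only: val cong: sum.cong)
    also have "\<dots> = c + measure_pmf.expectation (traj f mu0 Wd (g(i := gi)) T)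
          (\<lambda>s. if \<kappa> (Hv i t s) = k then B else 0)"
      using t by (subst sum.remove[of _ t]) auto
    also have "measure_pmf.expectation (traj f mu0 Wd (g(i := gi)) T)
          (\<lambda>s. if \<kappa> (Hv i t s) = k then B else 0) =
        measure_pmf.expectation (traj f mu0 Wd (g(i := gi)) (t - 1))
          (\<lambda>s. if \<kappa> (Hv i t s) = k then B else 0)"
      by (rule expectation_Hv_prefix[where F = "\<lambda>h. if \<kappa> h = k then B else 0"]) (use t in auto)
    also have "traj f mu0 Wd (g(i := gi)) (t - 1) = traj f mu0 Wd g (t - 1)"
      by (rule traj_cong) (auto simp: gi_def deviate_def fun_eq_iff)
    also have "measure_pmf.expectation (traj f mu0 Wd g (t - 1)) (\<lambda>s. if \<kappa> (Hv i t s) = k then B else 0) =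
        measure_pmf.expectation (traj f mu0 Wd g (t - 1)) (\<lambda>s. indicator {s. \<kappa> (Hv i t s) = k} s * B)"
      by (rule Bochner_Integration.integral_cong) auto
    also have "\<dots> = w t k * B" by (simp add: w_def)
    finally show "payoff f mu0 Wd T (g(i := deviate i (g i) t k \<alpha>)) i =
        payoff f mu0 Wd T g i + w t k * (\<Sum>u\<in>UNIV. pmf \<alpha> u * A t k u)"
      by (simp only: base gi_def B_def)
  next
    fix gi :: "('h,'u,'z) bstrat" assume gi: "is_bstrat Uset T i gi"
      and full: "\<And>t k. t \<in> {1..T} \<Longrightarrow> Uset t i \<subseteq> set_pmf (rho i t k)"
      and le: "\<And>t h. t \<in> {1..T} \<Longrightarrow> w t (\<kappa> h) > 0 \<Longrightarrow> (\<Sum>u\<in>UNIV. pmf (gi t h) u * A t (\<kappa> h) u) \<le> 0"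
    have "measure_pmf.expectation (traj f mu0 Wd (g(i := gi)) T)
        (\<lambda>s. \<Sum>u\<in>UNIV. pmf (gi t (Hv i t s)) u * A t (\<kappa> (Hv i t s)) u) \<le> 0" if t: "t \<in> {1..T}" for t
    proof -
      let ?F = "\<lambda>s. \<Sum>u\<in>UNIV. pmf (gi t (Hv i t s)) u * A t (\<kappa> (Hv i t s)) u"
      \<comment> \<open>This is where full support of \<open>rho\<close> enters: histories reached
        by the deviation are reached under \<open>g\<close> too, so \<open>w\<close> is positive at
        their compressed states and \<open>le\<close> applies to all of them.\<close>
      have "set_pmf (traj f mu0 Wd (g(i := gi)) (t - 1)) \<subseteq> set_pmf (traj f mu0 Wd g (t - 1))"
      proof (rule set_traj_mono)
        fix j t' h assume "t' \<in> {1..t - 1}"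
        then have t': "t' \<in> {1..T}" using t by auto
        then have "set_pmf (gi t' h) \<subseteq> set_pmf (g i t' h)"
          using gi full[OF t'] unfolding g_i is_bstrat_def by blast
        then show "set_pmf ((g(i := gi)) j t' h) \<subseteq> set_pmf (g j t' h)" by simp
      qed
      then have "?F s \<le> 0" if "s \<in> set_pmf (traj f mu0 Wd (g(i := gi)) (t - 1))" for s
        using that t unfolding w_def by (intro le) (auto simp: w_def intro!: measure_pmf_posI)
      then have "measure_pmf.expectation (traj f mu0 Wd (g(i := gi)) (t - 1)) ?F \<le> 0"
        using integral_nonneg_AE[of "\<lambda>s. - ?F s" "measure_pmf (traj f mu0 Wd (g(i := gi)) (t - 1))"]
        by (simp add: AE_measure_pmf_iff)
      moreover have "measure_pmf.expectation (traj f mu0 Wd (g(i := gi)) T) ?F =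
          measure_pmf.expectation (traj f mu0 Wd (g(i := gi)) (t - 1)) ?F"
        by (rule expectation_Hv_prefix[where F = "\<lambda>h. \<Sum>u\<in>UNIV. pmf (gi t h) u * A t (\<kappa> h) u"])
           (use t in auto)
      ultimately show ?thesis by simp
    qed
    then have "(\<Sum>t\<in>{1..T}. measure_pmf.expectation (traj f mu0 Wd (g(i := gi)) T)
        (\<lambda>s. \<Sum>u\<in>UNIV. pmf (gi t (Hv i t s)) u * A t (\<kappa> (Hv i t s)) u)) \<le> 0"
      by (rule sum_nonpos)
    then show "payoff f mu0 Wd T (g(i := gi)) i \<le> payoff f mu0 Wd T g i"
      unfolding base A[OF gi] by simp
  qed
qed

section \<open>Equilibrium of the trembling agents\<close>

definition tremble_profile :: "real \<Rightarrow> ('i \<times> nat \<times> 'k \<Rightarrow> 'u \<Rightarrow> real) \<Rightarrow> 'i \<Rightarrow> ('k, 'u) kstrat" where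
  "tremble_profile \<epsilon> q i t k = tremble \<epsilon> (Uset t i) (q (i, t, k))"

text \<open>The deviations of the trembling game must tremble as well. Any full-history strategy is
  recovered from its trembles as \<open>\<epsilon>\<close> tends to 0.\<close>

definition tremble_strategy :: "real \<Rightarrow> 'i \<Rightarrow> ('h,'u,'z) bstrat \<Rightarrow> ('h,'u,'z) bstrat" where
  "tremble_strategy \<epsilon> i gt = (\<lambda>t h. tremble \<epsilon> (Uset t i) (pmf (gt t h)))"

text \<open>By the one-shot deviation formula, a player's payoff is affine in the mixed action at each
  compressed state, so the average in the Nash map is the payoff of the profile itself.\<close>

lemma trembling_equilibrium_exists:
  assumes nonempty: "\<forall>t\<in>{1..T}. \<forall>i. Uset t i \<noteq> {}"
    and msi: "MSI f mu0 Wd T Uset iota1 iota"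
    and \<epsilon>: "0 < \<epsilon>" "\<epsilon> \<le> 1"
  obtains q where "\<And>i t k. t \<in> {1..T} \<Longrightarrow> q (i, t, k) \<in> simplex_on (Uset t i)"
    "\<And>i gt. is_bstrat Uset T i gt \<Longrightarrow>
      payoff f mu0 Wd T ((induced iota1 iota (tremble_profile \<epsilon> q))(i := tremble_strategy \<epsilon> i gt)) i
      \<le> payoff f mu0 Wd T (induced iota1 iota (tremble_profile \<epsilon> q)) i"
proof -
  define agents :: "('i \<times> nat \<times> 'k) set" where "agents = UNIV \<times> {1..T} \<times> UNIV"
  define S where "S = (\<lambda>(i, t, k :: 'k). Uset t i)"
  define \<sigma> :: "('i \<times> nat \<times> 'k \<Rightarrow> 'u \<Rightarrow> real) \<Rightarrow> 'i \<Rightarrow> ('h,'u,'z) bstrat"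
    where "\<sigma> q = induced iota1 iota (tremble_profile \<epsilon> q)" for q
  \<comment> \<open>An agent's pure action is itself trembled, so that \<open>G\<close> compares the
    extreme choices which the agent has in the restricted game.\<close>
  define dev where "dev q = (\<lambda>(i, t, k) u. (\<sigma> q)(i := deviate i (\<sigma> q i) t k
      (tremble \<epsilon> (Uset t i) (unit_vec u))))" for q :: "'i \<times> nat \<times> 'k \<Rightarrow> 'u \<Rightarrow> real"
  define G where "G q a u = payoff f mu0 Wd T (dev q a u) (fst a)" for q a u
  obtain q where q: "\<And>a. a \<in> agents \<Longrightarrow> q a \<in> simplex_on (S a)"
    and eq: "\<And>a u. a \<in> agents \<Longrightarrow> u \<in> S a \<Longrightarrow> G q a u \<le> (\<Sum>v\<in>UNIV. q a v * G q a v)"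
  proof (rule nash_map_fixed_point[of agents S G])
    show "finite agents" by (simp add: agents_def)
    show "S a \<noteq> {}" if "a \<in> agents" for a
      using that nonempty by (auto simp: agents_def S_def)
  next
    fix X :: "nat \<Rightarrow> 'i \<times> nat \<times> 'k \<Rightarrow> 'u \<Rightarrow> real" and x :: "'i \<times> nat \<times> 'k \<Rightarrow> 'u \<Rightarrow> real"
      and a :: "'i \<times> nat \<times> 'k" and u
    assume X: "\<forall>m. \<forall>b\<in>agents. X m b \<in> simplex_on (S b)" and x: "\<forall>b\<in>agents. x b \<in> simplex_on (S b)"
      and lim: "\<forall>b\<in>agents. \<forall>v. (\<lambda>m. X m b v) \<longlonglongrightarrow> x b v"
    have \<sigma>_lim: "(\<lambda>m. pmf (\<sigma> (X m) j t h) v) \<longlonglongrightarrow> pmf (\<sigma> x j t h) v" if "t \<in> {1..T}" for j t h v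
    proof -
      define k where "k = kcomp iota1 iota j h"
      have b: "(j, t, k) \<in> agents" using that by (simp add: agents_def)
      have "X m (j, t, k) \<in> simplex_on (Uset t j)" "x (j, t, k) \<in> simplex_on (Uset t j)" for m
        using X x b by (auto simp: S_def)
      then show ?thesis
        using lim b unfolding \<sigma>_def induced_def tremble_profile_def k_def[symmetric]
        by (auto simp: pmf_tremble[OF \<epsilon>] intro!: tendsto_intros)
    qed
    obtain i t k where a: "a = (i, t, k)" by (cases a)
    show "(\<lambda>m. G (X m) a u) \<longlonglongrightarrow> G x a u"
      unfolding G_def by (rule payoff_tendsto) (auto simp: a dev_def deviate_def \<sigma>_lim)
  qed blast
  have q': "q (i, t, k) \<in> simplex_on (Uset t i)" if "t \<in> {1..T}" for i t k
    using q[of "(i, t, k)"] that by (auto simp: agents_def S_def)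
  have kstrat: "is_kstrat Uset T i (tremble_profile \<epsilon> q i)" for i
    unfolding is_kstrat_def tremble_profile_def using set_tremble[OF \<epsilon> q'] by blast
  have "payoff f mu0 Wd T ((\<sigma> q)(i := tremble_strategy \<epsilon> i gt)) i \<le> payoff f mu0 Wd T (\<sigma> q) i"
    if gt: "is_bstrat Uset T i gt" for i gt
  proof -
    have info: "info_state f mu0 Wd T Uset iota1 iota i (induced iota1 iota (tremble_profile \<epsilon> q))"
      using msi kstrat unfolding MSI_def by blast
    show ?thesis
    proof (rule one_shot_deviation[OF info kstrat, folded \<sigma>_def])
      fix A :: "nat \<Rightarrow> 'k \<Rightarrow> 'u \<Rightarrow> real" and w :: "nat \<Rightarrow> 'k \<Rightarrow> real"
      assume A0: "\<And>t k. t \<in> {1..T} \<Longrightarrow> (\<Sum>u\<in>UNIV. pmf (tremble_profile \<epsilon> q i t k) u * A t k u) = 0"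
        and dev: "\<And>t k \<alpha>. t \<in> {1..T} \<Longrightarrow> set_pmf \<alpha> \<subseteq> Uset t i \<Longrightarrow>
          payoff f mu0 Wd T ((\<sigma> q)(i := deviate i (\<sigma> q i) t k \<alpha>)) i =
          payoff f mu0 Wd T (\<sigma> q) i + w t k * (\<Sum>u\<in>UNIV. pmf \<alpha> u * A t k u)"
        and opt: "\<And>gi. is_bstrat Uset T i gi \<Longrightarrow>
          (\<And>t k. t \<in> {1..T} \<Longrightarrow> Uset t i \<subseteq> set_pmf (tremble_profile \<epsilon> q i t k)) \<Longrightarrow>
          (\<And>t h. t \<in> {1..T} \<Longrightarrow> w t (kcomp iota1 iota i h) > 0 \<Longrightarrow>
            (\<Sum>u\<in>UNIV. pmf (gi t h) u * A t (kcomp iota1 iota i h) u) \<le> 0) \<Longrightarrow>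
          payoff f mu0 Wd T ((\<sigma> q)(i := gi)) i \<le> payoff f mu0 Wd T (\<sigma> q) i"
      define B where "B t k u = (\<Sum>v\<in>UNIV. pmf (tremble \<epsilon> (Uset t i) (unit_vec u)) v * A t k v)" for t k u
      \<comment> \<open>The average in the Nash inequality equals the payoff of
        \<open>\<sigma> q\<close>, because the advantage of the agent's own trembling mixture is
        zero. What remains is \<open>w t k * B t k u \<le> 0\<close>, and this bounds
        \<open>B\<close> exactly where the state is reached.\<close>
      have B: "B t k u \<le> 0" if t: "t \<in> {1..T}" and u: "u \<in> Uset t i" and "w t k > 0" for t k u
      proof -
        let ?a = "(i, t, k)"
        have G: "G q ?a v = payoff f mu0 Wd T (\<sigma> q) i + w t k * B t k v" if "v \<in> Uset t i" for v
          using dev[OF t, of "tremble \<epsilon> (Uset t i) (unit_vec v)" k]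
            set_tremble[OF \<epsilon> unit_vec_in_simplex_on[OF that]]
          by (simp add: G_def dev_def B_def)
        have "(\<Sum>v\<in>UNIV. q ?a v * G q ?a v) =
            (\<Sum>v\<in>UNIV. q ?a v * payoff f mu0 Wd T (\<sigma> q) i + w t k * (q ?a v * B t k v))"
        proof (rule sum.cong[OF refl])
          fix v
          show "q ?a v * G q ?a v = q ?a v * payoff f mu0 Wd T (\<sigma> q) i + w t k * (q ?a v * B t k v)"
            using G[of v] simplex_onD(2)[OF q'[OF t], of v i k] by (cases "v \<in> Uset t i") (auto simp: algebra_simps)
        qed
        also have "\<dots> = payoff f mu0 Wd T (\<sigma> q) i + w t k * (\<Sum>v\<in>UNIV. q ?a v * B t k v)"
          using simplex_onD(3)[OF q'[OF t], of i k]
          by (simp add: sum.distrib flip: sum_distrib_left sum_distrib_right)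
        also have "(\<Sum>v\<in>UNIV. q ?a v * B t k v) = 0"
          using A0[OF t, of k] sum_tremble[OF \<epsilon> q'[OF t], of i k "A t k"]
          by (simp add: B_def tremble_profile_def)
        finally have "G q ?a u \<le> payoff f mu0 Wd T (\<sigma> q) i"
          using eq[of ?a u] t u by (simp add: agents_def S_def)
        then show ?thesis using G[OF u] \<open>w t k > 0\<close> by (simp add: mult_le_0_iff)
      qed
      have gt_simplex: "pmf (gt t h) \<in> simplex_on (Uset t i)" if "t \<in> {1..T}" for t h
        using gt that unfolding is_bstrat_def by (intro pmf_in_simplex_on) blast
      show ?thesis
      proof (rule opt)
        show "is_bstrat Uset T i (tremble_strategy \<epsilon> i gt)"
          unfolding is_bstrat_def tremble_strategy_def using set_tremble[OF \<epsilon> gt_simplex] by blast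
        show "Uset t i \<subseteq> set_pmf (tremble_profile \<epsilon> q i t k)" if "t \<in> {1..T}" for t k
          unfolding tremble_profile_def using set_tremble[OF \<epsilon> q'[OF that]] by blast
        show "(\<Sum>u\<in>UNIV. pmf (tremble_strategy \<epsilon> i gt t h) u * A t (kcomp iota1 iota i h) u) \<le> 0"
          if t: "t \<in> {1..T}" and w: "w t (kcomp iota1 iota i h) > 0" for t h
        proof -
          \<comment> \<open>At a history \<open>h\<close> the trembling deviation is the average of
            trembled pure actions with weights \<open>gt t h\<close>. The bound \<open>B\<close>
            depends on \<open>h\<close> only through its compression, so it covers choices that vary
            among histories with the same compression.\<close>
          have "(\<Sum>u\<in>UNIV. pmf (tremble_strategy \<epsilon> i gt t h) u * A t (kcomp iota1 iota i h) u) =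
              (\<Sum>u\<in>UNIV. pmf (gt t h) u * B t (kcomp iota1 iota i h) u)"
            unfolding tremble_strategy_def B_def by (rule sum_tremble[OF \<epsilon> gt_simplex[OF t]])
          also have "\<dots> \<le> 0"
          proof (rule sum_nonpos)
            fix u
            show "pmf (gt t h) u * B t (kcomp iota1 iota i h) u \<le> 0"
              using B[OF t _ w, of u] simplex_onD(2)[OF gt_simplex[OF t], of u h]
              by (cases "u \<in> Uset t i") (auto simp: mult_le_0_iff)
          qed
          finally show ?thesis .
        qed
      qed
    qed
  qed
  then show ?thesis using that[of q] q' by (simp add: \<sigma>_def)
qed

end

section \<open>Passage to vanishing trembles\<close>

theorem theorem1:
  fixes T :: nat
    and f :: "nat \<Rightarrow> 'x::finite \<Rightarrow> ('i::finite \<Rightarrow> 'u::finite) \<Rightarrow> 'w::finite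
              \<Rightarrow> 'x \<times> ('i \<Rightarrow> 'z::finite) \<times> ('i \<Rightarrow> real)"
    and mu0 :: "('x \<times> ('i \<Rightarrow> 'h::finite)) pmf"
    and Wd :: "nat \<Rightarrow> 'w pmf"
    and Uset :: "nat \<Rightarrow> 'i \<Rightarrow> 'u set"
    and iota1 :: "'i \<Rightarrow> 'h \<Rightarrow> 'k::finite"
    and iota :: "nat \<Rightarrow> 'i \<Rightarrow> 'k \<Rightarrow> ('u \<times> 'z) \<Rightarrow> 'k"
  assumes actions_nonempty: "\<forall>t\<in>{1..T}. \<forall>i. Uset t i \<noteq> {}"
    and rewards_bounded: "\<forall>t\<in>{1..T}. \<forall>x u w i. snd (snd (f t x u w)) i \<in> {-1..1}"
    and msi: "MSI f mu0 Wd T Uset iota1 iota"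
  shows "\<exists>rho :: 'i \<Rightarrow> ('k, 'u) kstrat.
           (\<forall>i. is_kstrat Uset T i (rho i)) \<and>
           (\<forall>i. \<forall>gt :: ('h, 'u, 'z) bstrat. is_bstrat Uset T i gt \<longrightarrow>
              payoff f mu0 Wd T (induced iota1 iota rho) i
                \<ge> payoff f mu0 Wd T ((induced iota1 iota rho)(i := gt)) i)"
proof -
  define agents :: "('i \<times> nat \<times> 'k) set" where "agents = UNIV \<times> {1..T} \<times> UNIV"
  define \<epsilon> :: "nat \<Rightarrow> real" where "\<epsilon> m = inverse (real (Suc m))" for m
  have \<epsilon>: "0 < \<epsilon> m" "\<epsilon> m \<le> 1" for m by (auto simp: \<epsilon>_def inverse_le_1_iff)
  have "\<exists>q. (\<forall>i t k. t \<in> {1..T} \<longrightarrow> q (i, t, k) \<in> simplex_on (Uset t i)) \<and>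
    (\<forall>i gt. is_bstrat Uset T i gt \<longrightarrow>
      payoff f mu0 Wd T ((induced iota1 iota (tremble_profile Uset (\<epsilon> m) q))
        (i := tremble_strategy Uset (\<epsilon> m) i gt)) i
      \<le> payoff f mu0 Wd T (induced iota1 iota (tremble_profile Uset (\<epsilon> m) q)) i)" for m
    by (rule trembling_equilibrium_exists[OF actions_nonempty msi \<epsilon>]) blast
  then obtain q where q: "\<And>m i t k. t \<in> {1..T} \<Longrightarrow> q m (i, t, k) \<in> simplex_on (Uset t i)"
    and eq: "\<And>m i gt. is_bstrat Uset T i gt \<Longrightarrow>
      payoff f mu0 Wd T ((induced iota1 iota (tremble_profile Uset (\<epsilon> m) (q m)))
        (i := tremble_strategy Uset (\<epsilon> m) i gt)) i
      \<le> payoff f mu0 Wd T (induced iota1 iota (tremble_profile Uset (\<epsilon> m) (q m))) i"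
    by metis
  obtain r x where r: "strict_mono (r :: nat \<Rightarrow> nat)"
    and x: "\<And>b. b \<in> agents \<times> UNIV \<Longrightarrow> (\<lambda>m. (\<lambda>(a, u). q (r m) a u) b) \<longlonglongrightarrow> x b"
  proof (rule finite_index_seq_compact[of "agents \<times> UNIV" "\<lambda>m (a, u). q m a u"])
    show "finite (agents \<times> (UNIV :: 'u set))" by (simp add: agents_def)
    show "(\<lambda>(a, u). q m a u) b \<in> {0..1}" if "b \<in> agents \<times> UNIV" for m b
      using that simplex_onD(1)[OF q] simplex_on_le_1[OF q] by (auto simp: agents_def)
  qed blast
  define p where "p i t k u = x ((i, t, k), u)" for i t k u
  have lim: "(\<lambda>m. q (r m) (i, t, k) u) \<longlonglongrightarrow> p i t k u" if "t \<in> {1..T}" for i t k u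
    using x[of "((i, t, k), u)"] that by (simp add: agents_def p_def)
  have p: "p i t k \<in> simplex_on (Uset t i)" if t: "t \<in> {1..T}" for i t k
  proof -
    have "0 \<le> p i t k u" for u
      by (rule LIMSEQ_le_const[OF lim[OF t]]) (use simplex_onD(1)[OF q[OF t]] in blast)
    moreover have "p i t k u = 0" if "u \<notin> Uset t i" for u
      using LIMSEQ_unique[OF lim[OF t, of i k u]] simplex_onD(2)[OF q[OF t] that] by simp
    moreover have "sum (p i t k) UNIV = 1"
    proof (rule LIMSEQ_unique)
      show "(\<lambda>m. \<Sum>u\<in>UNIV. q (r m) (i, t, k) u) \<longlonglongrightarrow> sum (p i t k) UNIV"
        by (intro tendsto_sum lim[OF t])
      show "(\<lambda>m. \<Sum>u\<in>UNIV. q (r m) (i, t, k) u) \<longlonglongrightarrow> 1"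
        by (simp add: simplex_onD(3)[OF q[OF t]])
    qed
    ultimately show ?thesis by (simp add: simplex_on_def)
  qed
  \<comment> \<open>Limits were taken for agents at times in \<open>{1..T}\<close> only; at other
    times \<open>rho\<close> is an arbitrary distribution.\<close>
  define rho where "rho i t k = embed_pmf (p i t k)" for i t k
  have pmf_rho: "pmf (rho i t k) u = p i t k u" if "t \<in> {1..T}" for i t k u
    unfolding rho_def by (rule pmf_embed_simplex[OF p[OF that]])
  have "(\<lambda>m. \<epsilon> (r m)) \<longlonglongrightarrow> 0"
    using LIMSEQ_subseq_LIMSEQ[OF LIMSEQ_inverse_real_of_nat r] by (simp add: \<epsilon>_def o_def)
  then have \<epsilon>_lim: "(\<lambda>m. (1 - \<epsilon> (r m)) * y m + (if u \<in> S then \<epsilon> (r m) / card S else 0)) \<longlonglongrightarrow> y'"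
    if "y \<longlonglongrightarrow> y'" for y y' and u :: 'u and S
  proof -
    have "(\<lambda>m. (1 - \<epsilon> (r m)) * y m + (if u \<in> S then \<epsilon> (r m) / card S else 0))
        \<longlonglongrightarrow> (1 - 0) * y' + 0"
      using \<open>(\<lambda>m. \<epsilon> (r m)) \<longlonglongrightarrow> 0\<close> that by (cases "u \<in> S") (auto intro!: tendsto_eq_intros)
    then show ?thesis by simp
  qed
  have rho_lim: "(\<lambda>m. pmf (induced iota1 iota (tremble_profile Uset (\<epsilon> (r m)) (q (r m))) i t h) u)
      \<longlonglongrightarrow> pmf (induced iota1 iota rho i t h) u" if t: "t \<in> {1..T}" for i t u and h :: "('h,'u,'z) hist"
    unfolding induced_def tremble_profile_def pmf_tremble[OF \<epsilon> q[OF t]] pmf_rho[OF t]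
    by (rule \<epsilon>_lim[OF lim[OF t]])
  show ?thesis
  proof (intro exI[of _ rho] conjI allI impI)
    have "u \<in> Uset t i" if "t \<in> {1..T}" "u \<in> set_pmf (rho i t k)" for i t k u
      using that simplex_onD(2)[OF p[OF that(1)], of u i k] by (auto simp: set_pmf_iff pmf_rho)
    then show "is_kstrat Uset T i (rho i)" for i
      by (auto simp: is_kstrat_def)
  next
    fix i and gt :: "('h, 'u, 'z) bstrat" assume gt: "is_bstrat Uset T i gt"
    have gt_simplex: "pmf (gt t h) \<in> simplex_on (Uset t i)" if "t \<in> {1..T}" for t h
      using gt that unfolding is_bstrat_def by (intro pmf_in_simplex_on) blast
    show "payoff f mu0 Wd T ((induced iota1 iota rho)(i := gt)) i \<le> payoff f mu0 Wd T (induced iota1 iota rho) i"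
    \<comment> \<open>Both sides of the trembling equilibrium inequality are payoffs of converging
      profiles, and the weak inequality survives the limit. The deviation is fixed beforehand and
      approximated by its own trembles.\<close>
    proof (rule LIMSEQ_le)
      show "(\<lambda>m. payoff f mu0 Wd T (induced iota1 iota (tremble_profile Uset (\<epsilon> (r m)) (q (r m)))) i)
          \<longlonglongrightarrow> payoff f mu0 Wd T (induced iota1 iota rho) i"
        by (rule payoff_tendsto) (rule rho_lim)
      show "(\<lambda>m. payoff f mu0 Wd T ((induced iota1 iota (tremble_profile Uset (\<epsilon> (r m)) (q (r m))))
          (i := tremble_strategy Uset (\<epsilon> (r m)) i gt)) i)
          \<longlonglongrightarrow> payoff f mu0 Wd T ((induced iota1 iota rho)(i := gt)) i"
      proof (rule payoff_tendsto)
        fix j t h u assume t: "t \<in> {1..T}"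
        have "(\<lambda>m. pmf (tremble_strategy Uset (\<epsilon> (r m)) i gt t h) u) \<longlonglongrightarrow> pmf (gt t h) u"
          unfolding tremble_strategy_def pmf_tremble[OF \<epsilon> gt_simplex[OF t]]
          by (rule \<epsilon>_lim) simp
        then show "(\<lambda>m. pmf (((induced iota1 iota (tremble_profile Uset (\<epsilon> (r m)) (q (r m))))
          (i := tremble_strategy Uset (\<epsilon> (r m)) i gt)) j t h) u)
          \<longlonglongrightarrow> pmf (((induced iota1 iota rho)(i := gt)) j t h) u"
          using rho_lim[OF t] by (cases "j = i") auto
      qed
      show "\<exists>N. \<forall>m\<ge>N. payoff f mu0 Wd T ((induced iota1 iota (tremble_profile Uset (\<epsilon> (r m)) (q (r m))))
          (i := tremble_strategy Uset (\<epsilon> (r m)) i gt)) i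
        \<le> payoff f mu0 Wd T (induced iota1 iota (tremble_profile Uset (\<epsilon> (r m)) (q (r m)))) i"
        using eq[OF gt] by blast
    qed
  qed
qed

end
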